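(* Let $\epsilon>0$. Let $0<p_1<1<p_2$ be such that $\tilde\gamma(p_1)<\tilde\gamma(1)=\gamma^*$ and $\tilde\gamma(p_2)<\tilde\gamma(1)=\gamma^*$, and let $\delta\in\left(0,\min(\gamma^*-\tilde\gamma(p_1),\gamma^*-\tilde\gamma(p_2))\right)$. Fix the integer $k\ge 1$ to be such that $(1+\ln k)/k\le \delta^2\epsilon^2/16$. Then $$\mathbb{P}\left(A^n_{\epsilon,p_1,p_2}\right)\ge 1-\exp\left(-n\left(-\frac{1+\ln k}{k}+\frac{\delta^2\epsilon^2}{16}\right)\right)$$ for all $n=km$ ($m$ a positive integer) large enough, i.e. for all such $n\ge n_0(\epsilon,\delta)$ (the law of $X_1$ and $p_1,p_2$ being fixed).
   Context: Let $(X_i)_{i\ge1}$ and $(Y_i)_{i\ge1}$ be two independent iid sequences with the same non-degenerate law on a finite alphabet $\mathcal{A}$. For finite strings $x,y$, $|LCS(x;y)|$ denotes the length of a longest common subsequence (i.e. the maximal length of a string that is a, not necessarily contiguous, subsequence of both $x$ and $y$). Put $LC_n:=|LCS(X_1\cdots X_n;Y_1\cdots Y_n)|$ and $\gamma^*:=\lim_{n\to\infty}\mathbb{E}LC_n/n=\sup_{n\ge1}\mathbb{E}LC_n/n$. For $p>0$ let $$\tilde\gamma(p):=\lim_{n\to\infty}\frac{\mathbb{E}|LCS(X_1X_2\cdots X_n;Y_1Y_2\cdots Y_{np})|}{n(1+p)/2},$$ where a non-integer index $np$ is rounded up to the nearest positive integer (this limit exists, and $\tilde\gamma(1)=\gamma^*$).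 Throughout $n=km$ with $k,m$ positive integers. Consider integer vectors $\vec r=(r_0,r_1,\dots,r_m)$ with (I) $r_0=0<r_1<r_2<\cdots<r_{m-1}<r_m=n$. For $\epsilon,p_1,p_2>0$, $A^n_{\epsilon,p_1,p_2}$ is the event that for every integer vector $\vec r$ satisfying (I) and $$LC_n=\sum_{i=1}^m|LCS(X_{k(i-1)+1}X_{k(i-1)+2}\cdots X_{ki};Y_{r_{i-1}+1}Y_{r_{i-1}+2}\cdots Y_{r_i})|,$$ one has $$\mathrm{Card}\left(\{i\in\{1,2,\dots,m\}: kp_1\le r_i-r_{i-1}\le kp_2\}\right)\ge(1-\epsilon)m.$$ *)

theory Defs
  imports "HOL-Probability.Probability" "HOL-Library.Sublist"
begin

definition lcs_length :: "'a list \<Rightarrow> 'a list \<Rightarrow> nat" where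
  "lcs_length x y = Max (length ` {z. subseq z x \<and> subseq z y})"

text \<open>The sequences are indexed from 1 on; the values \<open>X 0\<close> and \<open>Y 0\<close> are never used.\<close>

locale two_iid_words = prob_space M
  for M :: "'b measure" and \<A> :: "'a set" and X Y :: "nat \<Rightarrow> 'b \<Rightarrow> 'a" +
  assumes finite_alphabet: "finite \<A>"
    and indep_X: "indep_vars (\<lambda>_. count_space \<A>) X {1..}"
    and indep_Y: "indep_vars (\<lambda>_. count_space \<A>) Y {1..}"
    and indep_X_Y: "indep_var
          (Pi\<^sub>M {1..} (\<lambda>_. count_space \<A>)) (\<lambda>\<omega>. \<lambda>i\<in>{1..}. X i \<omega>)
          (Pi\<^sub>M {1..} (\<lambda>_. count_space \<A>)) (\<lambda>\<omega>. \<lambda>i\<in>{1..}. Y i \<omega>)"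
    and law_X: "\<And>i. i \<ge> 1 \<Longrightarrow> distr M (count_space \<A>) (X i) = distr M (count_space \<A>) (X 1)"
    and law_Y: "\<And>i. i \<ge> 1 \<Longrightarrow> distr M (count_space \<A>) (Y i) = distr M (count_space \<A>) (X 1)"
    and nondegenerate: "\<not> (\<exists>a. AE \<omega> in M. X 1 \<omega> = a)"

text \<open>The word \<open>X\<^sub>a\<^sub>+\<^sub>1 \<dots> X\<^sub>b\<close>; it is empty if \<open>b \<le> a\<close>.\<close>

definition factor :: "(nat \<Rightarrow> 'b \<Rightarrow> 'a) \<Rightarrow> nat \<Rightarrow> nat \<Rightarrow> 'b \<Rightarrow> 'a list" where
  "factor X a b \<omega> = map (\<lambda>j. X j \<omega>) [a + 1..<b + 1]"

definition LC :: "(nat \<Rightarrow> 'b \<Rightarrow> 'a) \<Rightarrow> (nat \<Rightarrow> 'b \<Rightarrow> 'a) \<Rightarrow> nat \<Rightarrow> 'b \<Rightarrow> nat" where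
  "LC X Y n \<omega> = lcs_length (factor X 0 n \<omega>) (factor Y 0 n \<omega>)"

definition gamma_star ::
  "'b measure \<Rightarrow> (nat \<Rightarrow> 'b \<Rightarrow> 'a) \<Rightarrow> (nat \<Rightarrow> 'b \<Rightarrow> 'a) \<Rightarrow> real" where
  "gamma_star M X Y = lim (\<lambda>n. (\<integral>\<omega>. real (LC X Y n \<omega>) \<partial>M) / real n)"

definition gamma_tilde ::
  "'b measure \<Rightarrow> (nat \<Rightarrow> 'b \<Rightarrow> 'a) \<Rightarrow> (nat \<Rightarrow> 'b \<Rightarrow> 'a) \<Rightarrow> real \<Rightarrow> real" where
  "gamma_tilde M X Y p = lim (\<lambda>n.
     (\<integral>\<omega>. real (lcs_length (factor X 0 n \<omega>) (factor Y 0 (nat \<lceil>real n * p\<rceil>) \<omega>)) \<partial>M)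
       / (real n * (1 + p) / 2))"

lemma gamma_tilde_1: "gamma_tilde M X Y 1 = gamma_star M X Y"
  by (simp add: gamma_tilde_def gamma_star_def LC_def)

text \<open>The vector \<open>(r\<^sub>0, \<dots>, r\<^sub>m)\<close> is given by the values of \<open>r\<close> on \<open>{0..m}\<close>; its
  entries are nonnegative by condition (I), so natural numbers suffice.\<close>

definition cut_vector :: "nat \<Rightarrow> nat \<Rightarrow> (nat \<Rightarrow> nat) \<Rightarrow> bool" where
  "cut_vector n m r \<longleftrightarrow> r 0 = 0 \<and> (\<forall>i\<in>{1..m}. r (i - 1) < r i) \<and> r m = n"

text \<open>The event \<open>A\<^sup>n\<close> with parameters \<open>\<epsilon>, p\<^sub>1, p\<^sub>2\<close>, where \<open>n = k m\<close>.\<close>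

definition diagonal_event ::
  "'b measure \<Rightarrow> (nat \<Rightarrow> 'b \<Rightarrow> 'a) \<Rightarrow> (nat \<Rightarrow> 'b \<Rightarrow> 'a) \<Rightarrow> nat \<Rightarrow> nat
     \<Rightarrow> real \<Rightarrow> real \<Rightarrow> real \<Rightarrow> 'b set" where
  "diagonal_event M X Y k m \<epsilon> p1 p2 = {\<omega> \<in> space M. \<forall>r.
     cut_vector (k * m) m r \<and>
     LC X Y (k * m) \<omega> =
       (\<Sum>i = 1..m. lcs_length (factor X (k * (i - 1)) (k * i) \<omega>) (factor Y (r (i - 1)) (r i) \<omega>))
     \<longrightarrow>
     real (card {i \<in> {1..m}. real k * p1 \<le> real (r i) - real (r (i - 1)) \<and>
                              real (r i) - real (r (i - 1)) \<le> real k * p2})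
       \<ge> (1 - \<epsilon>) * real m}"

end

theory Submission
  imports Defs
begin

text \<open>
  Let \<open>e(a, b)\<close> be the mean length of a longest common subsequence of independent random words of
  lengths \<open>a\<close> and \<open>b\<close>. It is superadditive and symmetric, so concatenating pairs of words of
  lengths \<open>(a, b)\<close> and \<open>(b, a)\<close> in suitable proportion gives
  \<open>e(a, b) \<le> \<gamma>(p) (a + b) / 2\<close>, where \<open>\<gamma>\<close> is the function \<open>gamma_tilde\<close>, whenever \<open>p\<close> lies
  between \<open>b / a\<close> and 1. Hence a cut vector with more than \<open>\<epsilon> m\<close> blocks of length outside
  \<open>[k p1, k p2]\<close> has a mean score smaller than the mean of \<open>LC\<close> by at least \<open>\<delta> \<epsilon> n / 2\<close> once
  \<open>n\<close> is large. Both scores change by at most 1 with a single letter, so McDiarmid's inequality for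
  the \<open>2 n\<close> letters bounds the probability that such a cut vector is optimal by
  \<open>exp (- n \<delta>\<^sup>2 \<epsilon>\<^sup>2 / 16)\<close>, and there are at most \<open>n choose m \<le> (exp 1 * k) ^ m\<close> cut vectors.
\<close>

section \<open>Longest common subsequences\<close>

lemma finite_common_subseqs: "finite {z. subseq z x \<and> subseq z y}"
  by (rule finite_subset[of _ "set (List.subseqs x)"]) auto

lemma length_le_lcs_length:
  assumes "subseq z x" "subseq z y"
  shows "length z \<le> lcs_length x y"
  unfolding lcs_length_def using assms finite_common_subseqs by (intro Max_ge) auto

lemma lcs_length_witness:
  obtains z where "subseq z x" "subseq z y" "length z = lcs_length x y"
proof -
  have "lcs_length x y \<in> length ` {z. subseq z x \<and> subseq z y}"
    unfolding lcs_length_def by (rule Max_in) (auto simp: finite_common_subseqs)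
  with that show thesis by auto
qed

lemma lcs_length_commute: "lcs_length x y = lcs_length y x"
  by (simp add: lcs_length_def conj_commute)

lemma lcs_length_le_length: "lcs_length x y \<le> length x"
  by (metis lcs_length_witness list_emb_length)

lemma lcs_length_mono:
  assumes "subseq x x'" "subseq y y'"
  shows "lcs_length x y \<le> lcs_length x' y'"
proof -
  obtain z where "subseq z x" "subseq z y" "length z = lcs_length x y"
    by (rule lcs_length_witness)
  then show ?thesis
    using assms length_le_lcs_length[of z x' y'] subseq_order.trans by metis
qed

lemma lcs_length_append:
  "lcs_length x y + lcs_length x' y' \<le> lcs_length (x @ x') (y @ y')"
proof -
  obtain z where "subseq z x" "subseq z y" "length z = lcs_length x y"
    by (rule lcs_length_witness)
  moreover obtain z' where "subseq z' x'" "subseq z' y'" "length z' = lcs_length x' y'"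
    by (rule lcs_length_witness)
  ultimately show ?thesis
    using length_le_lcs_length[of "z @ z'" "x @ x'" "y @ y'"] by (simp add: list_emb_append_mono)
qed

text \<open>A longest common subsequence splits along \<open>u\<close>, \<open>w\<close>,
  \<open>v\<close>; dropping the part taken from \<open>w\<close> leaves a common subsequence of
  \<open>u @ v\<close> and \<open>y\<close> and costs at most \<open>length w\<close>
  letters.\<close>

lemma lcs_length_insert_le: "lcs_length (u @ w @ v) y \<le> lcs_length (u @ v) y + length w"
proof -
  obtain z where z: "subseq z (u @ w @ v)" "subseq z y" "length z = lcs_length (u @ w @ v) y"
    by (rule lcs_length_witness)
  obtain z1 z2 z3 where d: "z = z1 @ z2 @ z3" "subseq z1 u" "subseq z2 w" "subseq z3 v"
    using z(1) by (metis subseq_appendE)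
  have "subseq (z1 @ z3) z"
    unfolding d(1) by (intro list_emb_append_mono subseq_drop_many) auto
  then have "length (z1 @ z3) \<le> lcs_length (u @ v) y"
    using d z(2) subseq_order.trans by (intro length_le_lcs_length list_emb_append_mono) auto
  moreover have "length z2 \<le> length w"
    using d(3) list_emb_length by auto
  ultimately show ?thesis
    using z(3) d(1) by simp
qed

text \<open>Deleting the letter at position \<open>j\<close> cannot raise the score, and inserting
  \<open>c\<close> there adds at most 1.\<close>

lemma lcs_length_update_le: "lcs_length (x[j := c]) y \<le> lcs_length x y + 1"
proof (cases "j < length x")
  case True
  have "lcs_length (x[j := c]) y \<le> lcs_length (take j x @ drop (Suc j) x) y + 1"
    using lcs_length_insert_le[of "take j x" "[c]" "drop (Suc j) x" y] True
    by (simp add: upd_conv_take_nth_drop)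
  also have "lcs_length (take j x @ drop (Suc j) x) y \<le> lcs_length x y"
  proof (rule lcs_length_mono)
    have "subseq (take j x @ drop (Suc j) x) (take j x @ drop j x)"
      by (simp only: subseq_append' Cons_nth_drop_Suc[OF True, symmetric] subseq_order.refl list_emb_Cons)
    then show "subseq (take j x @ drop (Suc j) x) x" by simp
  qed simp
  finally show ?thesis by simp
qed (simp add: list_update_beyond)

lemma lcs_length_update: "\<bar>real (lcs_length (x[j := c]) y) - real (lcs_length x y)\<bar> \<le> 1"
  \<comment> \<open>The second instance writes the old letter \<open>x ! j\<close> back, which gives
    the reverse inequality.\<close>
  using lcs_length_update_le[of x j c y] lcs_length_update_le[of "x[j := c]" j "x ! j" y] by simp

section \<open>Sums of block scores and their sensitivity to one letter\<close>

definition blocks_lcs ::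
  "nat \<Rightarrow> (nat \<Rightarrow> nat) \<Rightarrow> (nat \<Rightarrow> nat) \<Rightarrow> 'a list \<Rightarrow> 'a list \<Rightarrow> nat" where
  "blocks_lcs m s r x y =
     (\<Sum>i = 1..m. lcs_length (drop (s (i - 1)) (take (s i) x)) (drop (r (i - 1)) (take (r i) y)))"

text \<open>Each word carries its own cut function, so bounds for changes in the second word follow
  from those for the first.\<close>

lemma blocks_lcs_commute: "blocks_lcs m s r x y = blocks_lcs m r s y x"
  by (simp add: blocks_lcs_def lcs_length_commute)

lemma block_update:
  fixes x :: "'a list"
  shows "drop a (take b (x[j := c])) =
    (if a \<le> j \<and> j < b then (drop a (take b x))[j - a := c] else drop a (take b x))"
  by (cases "j < b") (auto simp: take_update_swap drop_update_swap not_less list_update_beyond)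

text \<open>The blocks are disjoint, so a changed letter affects at most one summand, and that one
  by at most 1.\<close>

lemma blocks_lcs_update_left:
  assumes mono: "\<And>i. i \<in> {1..m} \<Longrightarrow> s (i - 1) \<le> s i"
  shows "\<bar>real (blocks_lcs m s r (x[j := c]) y) - real (blocks_lcs m s r x y)\<bar> \<le> 1"
proof -
  let ?h = "\<lambda>i z. real (lcs_length (drop (s (i - 1)) (take (s i) z)) (drop (r (i - 1)) (take (r i) y)))"
  \<comment> \<open>By monotonicity of \<open>s\<close>, \<open>?g i - ?g (i - 1)\<close> is 1 if
    position \<open>j\<close> lies in block \<open>i\<close> and 0 otherwise; these differences
    telescope.\<close>
  let ?g = "\<lambda>i. if j < s i then 1 else 0 :: real"
  have "\<bar>real (blocks_lcs m s r (x[j := c]) y) - real (blocks_lcs m s r x y)\<bar>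
      = \<bar>\<Sum>i = 1..m. ?h i (x[j := c]) - ?h i x\<bar>"
    by (simp add: blocks_lcs_def sum_subtractf)
  also have "\<dots> \<le> (\<Sum>i = 1..m. \<bar>?h i (x[j := c]) - ?h i x\<bar>)"
    by (rule sum_abs)
  also have "\<dots> \<le> (\<Sum>i = 1..m. ?g i - ?g (i - 1))"
  proof (rule sum_mono)
    fix i assume "i \<in> {1..m}"
    from mono[OF this] show "\<bar>?h i (x[j := c]) - ?h i x\<bar> \<le> ?g i - ?g (i - 1)"
      by (auto simp: block_update lcs_length_update simp del: drop_take)
  qed
  also have "\<dots> = ?g m - ?g 0"
    using sum_telescope''[of 0 m ?g] by simp
  also have "\<dots> \<le> 1" by simp
  finally show ?thesis .
qed

lemma blocks_lcs_update_right:
  assumes "\<And>i. i \<in> {1..m} \<Longrightarrow> r (i - 1) \<le> r i"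
  shows "\<bar>real (blocks_lcs m s r x (y[j := c])) - real (blocks_lcs m s r x y)\<bar> \<le> 1"
  using blocks_lcs_update_left[of m r s y j c x] assms by (simp add: blocks_lcs_commute)

section \<open>Superadditive sequences and cut vectors\<close>

text \<open>Fekete's lemma; the constant \<open>c\<close> absorbs the rounding of \<open>n p\<close>.\<close>

lemma superadditive_convergent:
  fixes u :: "nat \<Rightarrow> real"
  assumes super: "\<And>m n. u m + u n - c \<le> u (m + n)"
    and bound: "\<And>n. u n \<le> C * real n"
  shows "convergent (\<lambda>n. u n / real n)"
proof -
  \<comment> \<open>Subtracting \<open>c\<close> makes the sequence exactly superadditive, and
    \<open>c / n\<close> tends to 0.\<close>
  define v where "v n = u n - c" for n
  have v_add: "v m + v n \<le> v (m + n)" for m n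
    using super[of m n] by (simp add: v_def)
  have v_mult: "real q * v N + v r \<le> v (q * N + r)" for q N r
  proof (induction q)
    case (Suc q)
    then show ?case using v_add[of N "q * N + r"] by (simp add: algebra_simps)
  qed simp
  define L where "L = (SUP n\<in>{1..}. v n / real n)"
  have bdd: "bdd_above ((\<lambda>n. v n / real n) ` {1..})"
  proof (rule bdd_aboveI2)
    fix n :: nat assume n: "n \<in> {1..}"
    have "v n / real n = u n / real n + - (c / real n)"
      by (simp add: v_def diff_divide_distrib)
    also have "\<dots> \<le> C + \<bar>c\<bar>"
    proof (rule add_mono)
      show "u n / real n \<le> C"
        using bound[of n] n by (simp add: divide_le_eq)
      have "\<bar>c\<bar> \<le> \<bar>c\<bar> * real n" using n by (simp add: mult_le_cancel_left1)
      then have "\<bar>c / real n\<bar> \<le> \<bar>c\<bar>" using n by (simp add: abs_divide divide_le_eq)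
      then show "- (c / real n) \<le> \<bar>c\<bar>" by linarith
    qed
    finally show "v n / real n \<le> C + \<bar>c\<bar>" .
  qed
  have upper: "v n / real n \<le> L" if "n \<ge> 1" for n
    unfolding L_def using that by (intro cSUP_upper bdd) auto
  have v_lim: "(\<lambda>n. v n / real n) \<longlonglongrightarrow> L"
  proof (rule order_tendstoI)
    fix a assume "L < a"
    show "eventually (\<lambda>n. v n / real n < a) sequentially"
      using eventually_ge_at_top[of 1]
      by eventually_elim (use upper \<open>L < a\<close> in force)
  next
    fix a assume "a < L"
    then obtain N where N: "N \<ge> 1" "a < v N / real N"
      unfolding L_def by (subst (asm) less_cSUP_iff) (use bdd in auto)
    \<comment> \<open>For \<open>n = q * N + r\<close> with \<open>r < N\<close>, the constant
      \<open>B\<close> bounds the effect of the remainder \<open>r\<close> from below, uniformly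
      over the residues, so that it vanishes after division by \<open>n\<close>.\<close>
    define B where "B = Min ((\<lambda>r. v r - real r * (v N / real N)) ` {..<N})"
    have B: "B \<le> v r - real r * (v N / real N)" if "r < N" for r
      unfolding B_def using that by (intro Min_le) auto
    have lower: "v N / real N + B / real n \<le> v n / real n" if n: "n \<ge> 1" for n
    proof -
      have dec: "n = n div N * N + n mod N" by simp
      have "real n * (v N / real N) + B = real (n div N) * v N + real (n mod N) * (v N / real N) + B"
        using N by (subst (1) dec, subst of_nat_add) (simp add: algebra_simps)
      also have "\<dots> \<le> real (n div N) * v N + v (n mod N)"
        using B[of "n mod N"] N by simp
      also have "\<dots> \<le> v n"
        using v_mult[of "n div N" N "n mod N"] by simp
      finally have "(real n * (v N / real N) + B) / real n \<le> v n / real n"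
        by (rule divide_right_mono) simp
      then show ?thesis
        using n by (simp add: add_divide_distrib)
    qed
    have "(\<lambda>n. v N / real N + B / real n) \<longlonglongrightarrow> v N / real N + 0"
      by (intro tendsto_intros lim_const_over_n)
    then have "eventually (\<lambda>n. a < v N / real N + B / real n) sequentially"
      using N(2) by (intro order_tendstoD(1)) auto
    then show "eventually (\<lambda>n. a < v n / real n) sequentially"
      using eventually_ge_at_top[of 1] by eventually_elim (use lower in force)
  qed
  have "(\<lambda>n. v n / real n + c / real n) \<longlonglongrightarrow> L + 0"
    by (intro tendsto_add v_lim lim_const_over_n)
  moreover have "v n / real n + c / real n = u n / real n" for n
    by (simp add: v_def diff_divide_distrib)
  ultimately show ?thesis
    unfolding convergent_def by auto
qed

text \<open>The term of index \<open>m\<close> in the exponential series at \<open>m\<close> gives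
  \<open>m ^ m \<le> exp m * fact m\<close>; this is combined with
  \<open>(k * m choose m) * fact m \<le> (k * m) ^ m\<close>.\<close>

lemma binomial_le_exp_power: "real (k * m choose m) \<le> (exp 1 * real k) ^ m"
proof -
  have "(\<Sum>i\<in>{m}. real m ^ i /\<^sub>R fact i) \<le> exp (real m)"
    unfolding exp_def by (intro sum_le_suminf summable_exp_generic) auto
  then have "real m ^ m \<le> exp (real m) * fact m"
    by (simp add: field_simps)
  also have "exp (real m) = exp 1 ^ m"
    by (simp add: exp_of_nat_mult[symmetric])
  finally have m: "real m ^ m \<le> exp 1 ^ m * fact m" .
  have "real (k * m choose m) * fact m \<le> real ((k * m) ^ m)"
    using binomial_fact_pow[of "k * m" m] by (metis of_nat_fact of_nat_le_iff of_nat_mult)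
  also have "\<dots> = real k ^ m * real m ^ m"
    by (simp add: power_mult_distrib)
  also have "\<dots> \<le> real k ^ m * (exp 1 ^ m * fact m)"
    by (intro mult_left_mono m) simp
  also have "\<dots> = (exp 1 * real k) ^ m * fact m"
    by (simp add: power_mult_distrib)
  finally show ?thesis by simp
qed

section \<open>Finiteness and number of cut vectors\<close>

lemma cut_vector_strict_mono:
  assumes "cut_vector n m r" "i < j" "j \<le> m"
  shows "r i < r j"
  using assms(2,3)
proof (induction j)
  case (Suc j)
  have "r j < r (Suc j)"
    using assms(1) Suc.prems by (force simp: cut_vector_def dest: bspec[of _ _ "Suc j"])
  then show ?case using Suc by (cases "i = j") auto
qed simp

lemma cut_vector_le:
  assumes "cut_vector n m r" "i \<le> m"
  shows "r i \<le> n"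
  using cut_vector_strict_mono[OF assms(1), of i m] assms by (cases "i = m") (auto simp: cut_vector_def)

text \<open>\<open>cut_vector\<close> constrains only the values on \<open>{0..m}\<close>;
  extensionality selects one representative for each vector, so that vectors can be counted.\<close>

definition cut_vectors :: "nat \<Rightarrow> nat \<Rightarrow> (nat \<Rightarrow> nat) set" where
  "cut_vectors n m = {r \<in> extensional {0..m}. cut_vector n m r}"

text \<open>Since \<open>r 1 < ... < r m\<close>, sorting the set of values recovers these entries;
  \<open>r 0 = 0\<close> and the values outside \<open>{0..m}\<close> are fixed.\<close>

lemma cut_vectors_inj: "inj_on (\<lambda>r. r ` {1..m}) (cut_vectors n m)"
proof (rule inj_onI)
  fix r r' assume r: "r \<in> cut_vectors n m" "r' \<in> cut_vectors n m" and eq: "r ` {1..m} = r' ` {1..m}"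
  have sorted: "sorted (map q [1..<Suc m])" "distinct (map q [1..<Suc m])"
    if "q \<in> cut_vectors n m" for q
  proof -
    have "sorted_wrt (<) (map q [1..<Suc m])"
      using that cut_vector_strict_mono[of n m q]
      by (auto simp: cut_vectors_def sorted_wrt_map simp del: upt_Suc intro!: sorted_wrt_mono_rel[OF _ sorted_wrt_upt])
    then show "sorted (map q [1..<Suc m])" "distinct (map q [1..<Suc m])"
      by (simp_all add: strict_sorted_iff del: upt_Suc)
  qed
  have "map r [1..<Suc m] = map r' [1..<Suc m]"
    using eq by (intro sorted_distinct_set_unique sorted r) (simp del: upt_Suc add: atLeastLessThanSuc_atLeastAtMost)
  then have "r i = r' i" if "i \<in> {1..m}" for i
    using that by (simp del: upt_Suc)
  moreover have "r 0 = r' 0"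
    using r by (simp add: cut_vectors_def cut_vector_def)
  ultimately show "r = r'"
    using r by (intro extensionalityI[of r "{0..m}" r'])
      (auto simp: cut_vectors_def, metis One_nat_def Suc_leI atLeastAtMost_iff gr0I)
qed

lemma cut_vectors_image:
  "(\<lambda>r. r ` {1..m}) ` cut_vectors n m \<subseteq> {S. S \<subseteq> {1..n} \<and> card S = m}"
proof safe
  fix r assume r: "r \<in> cut_vectors n m"
  then have cv: "cut_vector n m r" by (simp add: cut_vectors_def)
  show "r i \<in> {1..n}" if "i \<in> {1..m}" for i
    using that cut_vector_strict_mono[OF cv, of 0 i] cut_vector_le[OF cv, of i] by auto
  have "inj_on r {1..m}"
    using cut_vector_strict_mono[OF cv] by (intro linorder_inj_onI) (auto simp: less_imp_neq)
  then show "card (r ` {1..m}) = m" by (simp add: card_image)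
qed

lemma finite_cut_vectors: "finite (cut_vectors n m)"
  by (rule finite_imageD[OF finite_subset[OF cut_vectors_image] cut_vectors_inj]) simp

lemma card_cut_vectors_le: "card (cut_vectors n m) \<le> n choose m"
  using card_inj_on_le[OF cut_vectors_inj cut_vectors_image] by (simp add: n_subsets)

section \<open>McDiarmid's inequality\<close>

lemma expectation_bind_pmf:
  fixes p :: "'a pmf" and h :: "'b \<Rightarrow> real"
  assumes "finite (set_pmf p)" "\<And>x. x \<in> set_pmf p \<Longrightarrow> finite (set_pmf (f x))"
  shows "measure_pmf.expectation (p \<bind> f) h =
    measure_pmf.expectation p (\<lambda>x. measure_pmf.expectation (f x) h)"
  using assms pmf_expectation_bind[of "set_pmf p" f p h]
    integral_measure_pmf[of "set_pmf p" p "\<lambda>x. measure_pmf.expectation (f x) h"] by simp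

lemma finite_set_replicate_pmf:
  "finite (set_pmf p) \<Longrightarrow> finite (set_pmf (replicate_pmf n p))"
  using finite_lists_length_eq[of "set_pmf p" n] by (simp add: set_replicate_pmf lists_eq_set)

lemma expectation_replicate_pmf_Suc:
  fixes h :: "'a list \<Rightarrow> real"
  assumes "finite (set_pmf p)"
  shows "measure_pmf.expectation (replicate_pmf (Suc n) p) h =
    measure_pmf.expectation p (\<lambda>x. measure_pmf.expectation (replicate_pmf n p) (\<lambda>xs. h (x # xs)))"
  using assms by (simp add: expectation_bind_pmf finite_set_replicate_pmf)

lemma expectation_mono_pmf:
  fixes f g :: "'a \<Rightarrow> real"
  assumes "finite (set_pmf p)" "\<And>x. x \<in> set_pmf p \<Longrightarrow> f x \<le> g x"
  shows "measure_pmf.expectation p f \<le> measure_pmf.expectation p g"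
  using assms by (intro integral_mono_AE integrable_measure_pmf_finite) (auto simp: AE_measure_pmf_iff)

text \<open>If \<open>a\<close> is the minimum of \<open>g\<close> on the support, the bound on
  differences confines \<open>g\<close> to \<open>[a, a + c]\<close>, and Hoeffding's lemma for
  bounded variables applies.\<close>

lemma Hoeffdings_lemma_pmf:
  fixes g :: "'a \<Rightarrow> real"
  assumes fin: "finite (set_pmf p)" and "l > 0"
    and diff: "\<And>x y. x \<in> set_pmf p \<Longrightarrow> y \<in> set_pmf p \<Longrightarrow> \<bar>g x - g y\<bar> \<le> c"
  shows "measure_pmf.expectation p (\<lambda>x. exp (l * (g x - measure_pmf.expectation p g)))
           \<le> exp (l\<^sup>2 * c\<^sup>2 / 8)"
proof -
  define a where "a = Min (g ` set_pmf p)"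
  have "a \<in> g ` set_pmf p"
    unfolding a_def using fin by (intro Min_in) (auto simp: set_pmf_not_empty)
  then obtain x0 where x0: "x0 \<in> set_pmf p" "a = g x0" by auto
  have range: "a \<le> g x" "g x \<le> a + c" if "x \<in> set_pmf p" for x
  proof -
    show "a \<le> g x" unfolding a_def using fin that by auto
    show "g x \<le> a + c" using diff[OF that x0(1)] x0(2) by simp
  qed
  interpret interval_bounded_random_variable "measure_pmf p" g a "a + c"
    by unfold_locales (auto simp: AE_measure_pmf_iff range)
  have "ennreal (measure_pmf.expectation p (\<lambda>x. exp (l * (g x - measure_pmf.expectation p g))))
     = nn_integral p (\<lambda>x. exp (l * (g x - measure_pmf.expectation p g)))"
    by (rule nn_integral_eq_integral[symmetric]) (auto intro!: integrable_measure_pmf_finite fin)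
  also have "\<dots> \<le> ennreal (exp (l\<^sup>2 * (a + c - a)\<^sup>2 / 8))"
    by (rule Hoeffdings_lemma_nn_integral) fact
  finally show ?thesis by simp
qed

text \<open>The martingale of conditional expectations given the first letters is hidden in the
  induction: \<open>g\<close> integrates out all letters but the first.\<close>

lemma mgf_bounded_differences:
  fixes f :: "'a list \<Rightarrow> real"
  assumes fin: "finite (set_pmf p)" and "l > 0"
    and "\<And>w j a. length w = n \<Longrightarrow> j < n \<Longrightarrow> \<bar>f (w[j := a]) - f w\<bar> \<le> c"
  shows "measure_pmf.expectation (replicate_pmf n p)
           (\<lambda>w. exp (l * (f w - measure_pmf.expectation (replicate_pmf n p) f)))
         \<le> exp (real n * (l\<^sup>2 * c\<^sup>2 / 8))"
  using assms(3)
proof (induction n arbitrary: f)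
  case 0
  then show ?case by simp
next
  case (Suc n)
  let ?E = "measure_pmf.expectation (replicate_pmf n p)"
  let ?K = "exp (real n * (l\<^sup>2 * c\<^sup>2 / 8))"
  define g where "g x = ?E (\<lambda>xs. f (x # xs))" for x
  note finr = finite_set_replicate_pmf[OF fin]
  note E_Suc = expectation_replicate_pmf_Suc[OF fin]
  have Ef: "measure_pmf.expectation (replicate_pmf (Suc n) p) f = measure_pmf.expectation p g"
    unfolding E_Suc g_def ..
  have IH: "?E (\<lambda>xs. exp (l * (f (x # xs) - g x))) \<le> ?K" for x
    unfolding g_def
  proof (rule Suc.IH)
    fix w :: "'a list" and j a assume "length w = n" "j < n"
    then show "\<bar>f (x # w[j := a]) - f (x # w)\<bar> \<le> c"
      using Suc.prems[of "x # w" "Suc j" a] by simp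
  qed
  \<comment> \<open>Changing the first letter changes \<open>f\<close> by at most \<open>c\<close>
    for every choice of the other letters, hence also on average.\<close>
  have g_diff: "\<bar>g x - g y\<bar> \<le> c" for x y
  proof -
    have "g x - g y = ?E (\<lambda>xs. f (x # xs) - f (y # xs))"
      unfolding g_def
      by (rule Bochner_Integration.integral_diff[symmetric]) (auto intro!: integrable_measure_pmf_finite finr)
    also have "\<bar>\<dots>\<bar> \<le> ?E (\<lambda>xs. \<bar>f (x # xs) - f (y # xs)\<bar>)"
      by (rule integral_abs_bound)
    also have "\<dots> \<le> ?E (\<lambda>_. c)"
    proof (rule expectation_mono_pmf[OF finr])
      fix xs assume "xs \<in> set_pmf (replicate_pmf n p)"
      then have "length xs = n" by (simp add: set_replicate_pmf)
      then show "\<bar>f (x # xs) - f (y # xs)\<bar> \<le> c"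
        using Suc.prems[of "y # xs" 0 x] by simp
    qed
    finally show ?thesis by simp
  qed
  \<comment> \<open>The first factor does not depend on \<open>xs\<close> and leaves the inner
    expectation; the induction hypothesis bounds the second, Hoeffding's lemma the first.\<close>
  have split: "exp (l * (f (x # xs) - e)) = exp (l * (g x - e)) * exp (l * (f (x # xs) - g x))"
    for x xs e
    by (simp add: exp_add[symmetric] right_diff_distrib)
  have "measure_pmf.expectation (replicate_pmf (Suc n) p)
          (\<lambda>w. exp (l * (f w - measure_pmf.expectation p g)))
      = measure_pmf.expectation p (\<lambda>x. exp (l * (g x - measure_pmf.expectation p g)) *
          ?E (\<lambda>xs. exp (l * (f (x # xs) - g x))))"
    unfolding E_Suc split[of _ _ "measure_pmf.expectation p g"] by simp
  also have "\<dots> \<le> measure_pmf.expectation p (\<lambda>x. exp (l * (g x - measure_pmf.expectation p g)) * ?K)"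
    by (intro expectation_mono_pmf fin mult_left_mono IH) simp
  also have "\<dots> = measure_pmf.expectation p (\<lambda>x. exp (l * (g x - measure_pmf.expectation p g))) * ?K"
    by simp
  also have "\<dots> \<le> exp (l\<^sup>2 * c\<^sup>2 / 8) * ?K"
    by (intro mult_right_mono Hoeffdings_lemma_pmf fin \<open>l > 0\<close> g_diff) simp
  also have "\<dots> = exp (real (Suc n) * (l\<^sup>2 * c\<^sup>2 / 8))"
    by (simp add: exp_add[symmetric] algebra_simps)
  finally show ?case unfolding Ef .
qed

text \<open>The lower tail of \<open>f\<close> is the upper tail of \<open>- f\<close>, to which the
  Chernoff bound is applied.\<close>

lemma McDiarmid_le:
  fixes f :: "'a list \<Rightarrow> real"
  assumes fin: "finite (set_pmf p)" and "t > 0" "c > 0" "n > 0"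
    and diff: "\<And>w j a. length w = n \<Longrightarrow> j < n \<Longrightarrow> \<bar>f (w[j := a]) - f w\<bar> \<le> c"
  shows "measure_pmf.prob (replicate_pmf n p)
           {w. f w \<le> measure_pmf.expectation (replicate_pmf n p) f - t}
         \<le> exp (- 2 * t\<^sup>2 / (real n * c\<^sup>2))"
proof -
  let ?P = "replicate_pmf n p"
  \<comment> \<open>This \<open>l\<close> minimises the exponent
    \<open>- l * t + n * l\<^sup>2 * c\<^sup>2 / 8\<close>.\<close>
  define l where "l = 4 * t / (real n * c\<^sup>2)"
  have l: "l > 0" using assms by (simp add: l_def)
  define h where "h w = - f w - measure_pmf.expectation ?P (\<lambda>w. - f w)" for w
  have "emeasure ?P {w \<in> UNIV. t \<le> h w} \<le>
      ennreal (exp (- l * t)) * nn_integral ?P (\<lambda>w. ennreal (exp (l * h w)) * indicator UNIV w)"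
    by (rule Chernoff_ineq_nn_integral_ge[OF l]) auto
  also have "nn_integral ?P (\<lambda>w. ennreal (exp (l * h w)) * indicator UNIV w)
      = ennreal (measure_pmf.expectation ?P (\<lambda>w. exp (l * h w)))"
    by (simp, rule nn_integral_eq_integral)
       (auto intro!: integrable_measure_pmf_finite finite_set_replicate_pmf fin)
  also have "\<dots> \<le> ennreal (exp (real n * (l\<^sup>2 * c\<^sup>2 / 8)))"
    unfolding h_def
  proof (intro ennreal_leI mgf_bounded_differences fin l)
    fix w :: "'a list" and j a assume "length w = n" "j < n"
    from diff[OF this, of a] show "\<bar>- f (w[j := a]) - - f w\<bar> \<le> c" by linarith
  qed
  finally have "emeasure ?P {w \<in> UNIV. t \<le> h w}
      \<le> ennreal (exp (- l * t) * exp (real n * (l\<^sup>2 * c\<^sup>2 / 8)))"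
    by (simp add: ennreal_mult mult_left_mono)
  also have "exp (- l * t) * exp (real n * (l\<^sup>2 * c\<^sup>2 / 8)) = exp (- 2 * t\<^sup>2 / (real n * c\<^sup>2))"
    unfolding exp_add[symmetric] l_def using assms by (simp add: field_simps power2_eq_square)
  also have "{w \<in> UNIV. t \<le> h w} = {w. f w \<le> measure_pmf.expectation ?P f - t}"
    by (auto simp: h_def)
  finally show ?thesis
    unfolding measure_pmf.emeasure_eq_measure by (subst (asm) ennreal_le_iff) auto
qed

text \<open>Head and tail of the word are independent and the cons map is injective, so the mass
  factorises by induction.\<close>

lemma pmf_replicate_pmf:
  "pmf (replicate_pmf n p) xs = (if length xs = n then \<Prod>i<n. pmf p (xs ! i) else 0)"
proof (induction n arbitrary: xs)
  case 0
  then show ?case by (auto simp: pmf_return)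
next
  case (Suc n)
  show ?case
  proof (cases xs)
    case Nil
    have "[] \<notin> set_pmf (replicate_pmf (Suc n) p)" unfolding set_replicate_pmf by simp
    then show ?thesis using Nil by (simp add: set_pmf_iff del: replicate_pmf.simps)
  next
    case (Cons x ys)
    have "replicate_pmf (Suc n) p = map_pmf (\<lambda>(x, xs). x # xs) (pair_pmf p (replicate_pmf n p))"
      by (simp add: pair_pmf_def map_bind_pmf)
    also have "pmf \<dots> xs = pmf (pair_pmf p (replicate_pmf n p)) (x, ys)"
    proof -
      have "inj (\<lambda>(x :: 'a, xs). x # xs)" by (auto intro: injI)
      from pmf_map_inj'[OF this, of _ "(x, ys)"] show ?thesis by (simp add: Cons)
    qed
    also have "\<dots> = pmf p x * (if length ys = n then \<Prod>i<n. pmf p (ys ! i) else 0)"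
      by (simp only: pmf_pair Suc.IH)
    also have "\<dots> = (if length xs = Suc n then \<Prod>i<Suc n. pmf p (xs ! i) else 0)"
      by (simp only: Cons prod.lessThan_Suc_shift) simp
    finally show ?thesis .
  qed
qed

section \<open>The joint law of two random words\<close>

text \<open>By induction on \<open>js\<close>: the first letter takes finitely many values, and for
  each of them the word is a measurable function of its tail.\<close>

lemma measurable_map_letters:
  assumes "finite A" and "\<And>j. j \<in> set js \<Longrightarrow> Z j \<in> N \<rightarrow>\<^sub>M count_space A"
  shows "(\<lambda>\<omega>. map (\<lambda>j. Z j \<omega>) js) \<in> N \<rightarrow>\<^sub>M count_space UNIV"
proof -
  have "(\<lambda>\<omega>. map (\<lambda>j. Z j \<omega>) js) \<in> N \<rightarrow>\<^sub>M count_space (lists A)"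
    using assms(2)
  proof (induction js)
    case (Cons j js)
    have "(\<lambda>\<omega>. a # map (\<lambda>j. Z j \<omega>) js) \<in> N \<rightarrow>\<^sub>M count_space (lists A)" if "a \<in> A" for a
      using that Cons by (intro measurable_compose[where g = "(#) a", OF Cons.IH]) auto
    then show ?case
      using measurable_compose_countable'[of A "\<lambda>a \<omega>. a # map (\<lambda>j. Z j \<omega>) js" N "count_space (lists A)" "Z j"]
        Cons.prems \<open>finite A\<close> by (simp add: countable_finite)
  qed simp
  then show ?thesis
    by (rule measurable_compose) simp
qed

lemma length_factor [simp]: "length (factor Z a b \<omega>) = b - a"
  by (simp add: factor_def del: upt_Suc)

lemma (in prob_space) prob_factor:
  assumes indep: "indep_vars (\<lambda>_. count_space A) Z {1..}"
    and law: "\<And>i a. i \<ge> 1 \<Longrightarrow> prob {\<omega> \<in> space M. Z i \<omega> = a} = pmf q a"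
  shows "prob {\<omega> \<in> space M. factor Z s (s + n) \<omega> = xs} = pmf (replicate_pmf n q) xs"
\<comment> \<open>Words of the wrong length and the empty word are set apart, because the product
  rule for independent events asks for a nonempty index set.\<close>
proof (cases "length xs = n \<and> n > 0")
  case False
  show ?thesis
  proof (cases "length xs = n")
    case True
    with False have "n = 0" "xs = []" by auto
    then show ?thesis by (simp add: factor_def prob_space)
  next
    case False
    then have "factor Z s (s + n) \<omega> \<noteq> xs" for \<omega>
      by (auto dest: arg_cong[where f = length])
    with False show ?thesis by (simp add: pmf_replicate_pmf)
  qed
next
  case True
  have Z_in: "Z i \<omega> \<in> A" if "i \<ge> 1" "\<omega> \<in> space M" for i \<omega>
  proof -
    have "Z i \<in> M \<rightarrow>\<^sub>M count_space A"
      using indep that(1) unfolding indep_vars_def by auto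
    from measurable_space[OF this that(2)] show ?thesis by simp
  qed
  let ?J = "(\<lambda>i. s + 1 + i) ` {..<n}"
  \<comment> \<open>Intersecting with \<open>A\<close> gives a measurable set of
    \<open>count_space A\<close> even if the prescribed letter lies outside
    \<open>A\<close>.\<close>
  let ?B = "\<lambda>j. {xs ! (j - (s + 1))} \<inter> A"
  have word: "factor Z s (s + n) \<omega> = xs \<longleftrightarrow> (\<forall>i<n. Z (s + 1 + i) \<omega> = xs ! i)" for \<omega>
    using True by (simp add: factor_def list_eq_iff_nth_eq del: upt_Suc)
  have "{\<omega> \<in> space M. factor Z s (s + n) \<omega> = xs} = (\<Inter>j\<in>?J. Z j -` ?B j \<inter> space M)"
    unfolding word using True Z_in by auto
  then have "prob {\<omega> \<in> space M. factor Z s (s + n) \<omega> = xs} =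
      prob (\<Inter>j\<in>?J. Z j -` ?B j \<inter> space M)"
    by simp
  also have "\<dots> = (\<Prod>j\<in>?J. prob (Z j -` ?B j \<inter> space M))"
    using True by (intro indep_varsD[OF indep]) auto
  also have "\<dots> = (\<Prod>i<n. prob (Z (s + 1 + i) -` ?B (s + 1 + i) \<inter> space M))"
    by (subst prod.reindex) (auto simp: inj_on_def)
  also have "\<dots> = (\<Prod>i<n. pmf q (xs ! i))"
  proof (rule prod.cong)
    fix i
    have "Z (s + 1 + i) -` ?B (s + 1 + i) \<inter> space M = {\<omega> \<in> space M. Z (s + 1 + i) \<omega> = xs ! i}"
      using Z_in[of "s + 1 + i"] by auto
    then show "prob (Z (s + 1 + i) -` ?B (s + 1 + i) \<inter> space M) = pmf q (xs ! i)"
      using law[of "s + 1 + i"] by simp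
  qed simp
  finally show ?thesis
    using True by (simp add: pmf_replicate_pmf)
qed

lemma factor_append:
  assumes "a \<le> b" "b \<le> c"
  shows "factor Z a c \<omega> = factor Z a b \<omega> @ factor Z b c \<omega>"
proof -
  have "[a + 1..<c + 1] = [a + 1..<b + 1] @ [b + 1..<c + 1]"
    using assms upt_add_eq_append[of "a + 1" "b + 1" "c - b"] by simp
  then show ?thesis by (simp add: factor_def del: upt_Suc)
qed

text \<open>Connects windows of the random sequences with the blocks in
  \<open>blocks_lcs\<close>.\<close>

lemma factor_eq_drop_take:
  assumes "a \<le> b" "b \<le> n"
  shows "factor Z a b \<omega> = drop a (take b (factor Z 0 n \<omega>))"
  using assms factor_append[of 0 b n Z \<omega>] factor_append[of 0 a b Z \<omega>] by simp

section \<open>Transfer of the random words to finitely supported laws on lists\<close>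

context two_iid_words
begin

text \<open>The discrete sigma-algebra of the whole type replaces \<open>count_space \<A>\<close>,
  as the type of probability mass functions requires.\<close>

definition letter_law :: "'a pmf" where
  "letter_law = Abs_pmf (distr M (count_space UNIV) (X 1))"

lemma measurable_letters:
  assumes "i \<ge> 1"
  shows "X i \<in> M \<rightarrow>\<^sub>M count_space \<A>" "Y i \<in> M \<rightarrow>\<^sub>M count_space \<A>"
  using indep_X indep_Y assms unfolding indep_vars_def by auto

text \<open>The law is carried by the finite set \<open>\<A>\<close>, so almost every point is an
  atom, and \<open>Abs_pmf\<close> is applied to a legitimate argument.\<close>

lemma measure_letter_law: "measure_pmf letter_law = distr M (count_space UNIV) (X 1)"
proof -
  have X1: "X 1 \<in> M \<rightarrow>\<^sub>M count_space UNIV"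
    by (rule measurable_compose[OF measurable_letters(1)]) simp_all
  interpret D: prob_space "distr M (count_space UNIV) (X 1)"
    by (rule prob_space_distr[OF X1])
  have "AE a in distr M (count_space UNIV) (X 1). a \<in> \<A>"
    using measurable_space[OF measurable_letters(1)[of 1]] by (subst AE_distr_iff[OF X1]) auto
  then have "AE a in distr M (count_space UNIV) (X 1). measure (distr M (count_space UNIV) (X 1)) {a} \<noteq> 0"
    using D.AE_support_countable finite_alphabet countable_finite by auto
  then show ?thesis
    unfolding letter_law_def
    by (intro Abs_pmf_inverse) (simp add: D.prob_space_axioms del: One_nat_def)
qed

lemma finite_letter_law: "finite (set_pmf letter_law)"
proof (rule finite_subset[OF _ finite_alphabet], rule subsetI)
  fix a assume "a \<in> set_pmf letter_law"
  then have "measure (distr M (count_space UNIV) (X 1)) {a} \<noteq> 0"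
    by (simp add: set_pmf.rep_eq measure_letter_law)
  moreover have "X 1 \<in> M \<rightarrow>\<^sub>M count_space UNIV"
    by (rule measurable_compose[OF measurable_letters(1)]) simp_all
  ultimately have "X 1 -` {a} \<inter> space M \<noteq> {}"
    by (auto simp: measure_distr)
  then show "a \<in> \<A>"
    using measurable_space[OF measurable_letters(1)[of 1]] by auto
qed

text \<open>Equality of laws is known only on \<open>count_space \<A>\<close>, so the event is
  expressed through \<open>{a} \<inter> \<A>\<close>.\<close>

lemma prob_eq_letter_law:
  assumes W: "W \<in> M \<rightarrow>\<^sub>M count_space \<A>"
    and law: "distr M (count_space \<A>) W = distr M (count_space \<A>) (X 1)"
  shows "prob {\<omega> \<in> space M. W \<omega> = a} = pmf letter_law a"
proof -
  have X1: "X 1 \<in> M \<rightarrow>\<^sub>M count_space \<A>" by (simp add: measurable_letters)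
  have X1': "X 1 \<in> M \<rightarrow>\<^sub>M count_space UNIV"
    by (rule measurable_compose[OF X1]) simp
  have eq: "{\<omega> \<in> space M. V \<omega> = a} = V -` ({a} \<inter> \<A>) \<inter> space M" if "V \<in> M \<rightarrow>\<^sub>M count_space \<A>" for V
    using measurable_space[OF that] by auto
  have "prob {\<omega> \<in> space M. W \<omega> = a} = measure (distr M (count_space \<A>) W) ({a} \<inter> \<A>)"
    by (simp add: eq[OF W] measure_distr W)
  also have "\<dots> = prob {\<omega> \<in> space M. X 1 \<omega> = a}"
    unfolding law eq[OF X1] by (rule measure_distr[OF X1]) simp
  also have "\<dots> = pmf letter_law a"
    unfolding pmf.rep_eq measure_letter_law
    by (subst measure_distr[OF X1']) (auto intro!: arg_cong[where f = prob])
  finally show ?thesis .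
qed

lemma prob_letters:
  assumes "i \<ge> 1"
  shows "prob {\<omega> \<in> space M. X i \<omega> = a} = pmf letter_law a"
    and "prob {\<omega> \<in> space M. Y i \<omega> = a} = pmf letter_law a"
  using assms by (auto intro!: prob_eq_letter_law measurable_letters law_X law_Y)

lemma measurable_factors:
  "factor X a b \<in> M \<rightarrow>\<^sub>M count_space UNIV" "factor Y a b \<in> M \<rightarrow>\<^sub>M count_space UNIV"
  unfolding factor_def[abs_def]
  by (auto intro!: measurable_map_letters[OF finite_alphabet] measurable_letters simp del: upt_Suc)

text \<open>Each word is a measurable function of its whole sequence, and the two sequences are
  independent.\<close>

lemma indep_factors:
  "indep_var (count_space UNIV) (factor X a b) (count_space UNIV) (factor Y c d)"
proof -
  let ?w = "\<lambda>a b u. map (\<lambda>j. u j) [a + 1..<b + 1]"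
  have w: "?w a b \<in> Pi\<^sub>M {1..} (\<lambda>_. count_space \<A>) \<rightarrow>\<^sub>M count_space UNIV" for a b
    by (rule measurable_map_letters[OF finite_alphabet])
       (auto intro!: measurable_component_singleton simp del: upt_Suc)
  have "factor Z a b = ?w a b \<circ> (\<lambda>\<omega>. \<lambda>i\<in>{1..}. Z i \<omega>)" for a b :: nat and Z :: "nat \<Rightarrow> 'b \<Rightarrow> 'a"
    by (auto simp: factor_def fun_eq_iff simp del: upt_Suc)
  with indep_var_compose[OF indep_X_Y w[of a b] w[of c d]] show ?thesis
    by simp
qed

lemma set_factors:
  assumes "\<omega> \<in> space M"
  shows "set (factor X a b \<omega>) \<subseteq> \<A>" "set (factor Y a b \<omega>) \<subseteq> \<A>"
  using assms measurable_letters[THEN measurable_space]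
  by (auto simp: factor_def simp del: upt_Suc)

text \<open>The values lie in the countable set of pairs of words over \<open>\<A>\<close>, so
  preimages of singletons suffice.\<close>

lemma measurable_factor_pair:
  "(\<lambda>\<omega>. (factor X a b \<omega>, factor Y c d \<omega>)) \<in> M \<rightarrow>\<^sub>M count_space UNIV"
proof -
  let ?F = "\<lambda>\<omega>. (factor X a b \<omega>, factor Y c d \<omega>)" and ?L = "lists \<A> \<times> lists \<A>"
  have L: "countable ?L"
    using finite_alphabet by (intro countable_SIGMA countable_lists countable_finite)
  have "?F \<in> M \<rightarrow>\<^sub>M count_space ?L"
    unfolding measurable_count_space_eq_countable[OF L]
  proof (intro conjI ballI)
    show "?F \<in> space M \<rightarrow> ?L"
      using set_factors by (fastforce simp: lists_eq_set)
    fix z :: "'a list \<times> 'a list"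
    have "?F -` {z} \<inter> space M =
        (factor X a b -` {fst z} \<inter> space M) \<inter> (factor Y c d -` {snd z} \<inter> space M)"
      by auto
    also have "\<dots> \<in> sets M"
      using measurable_factors by (intro sets.Int measurable_sets) auto
    finally show "?F -` {z} \<inter> space M \<in> sets M" .
  qed
  then show ?thesis by (rule measurable_compose) simp
qed

text \<open>The joint law depends on the lengths of the windows only, not on their positions. Both
  laws live on a countable set and agree on singletons.\<close>

lemma distr_factors:
  "distr M (count_space UNIV) (\<lambda>\<omega>. (factor X a (a + n) \<omega>, factor Y b (b + m) \<omega>)) =
     measure_pmf (pair_pmf (replicate_pmf n letter_law) (replicate_pmf m letter_law))"
    (is "?D = measure_pmf ?P")
proof (rule measure_eqI_countable_AE)
  let ?F = "\<lambda>\<omega>. (factor X a (a + n) \<omega>, factor Y b (b + m) \<omega>)"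
  note F = measurable_factor_pair[of a "a + n" b "b + m"]
  let ?L = "lists \<A> \<times> lists \<A>"
  show "AE x in ?D. x \<in> ?L \<union> set_pmf ?P"
    using set_factors by (subst AE_distr_iff[OF F]) (fastforce simp: lists_eq_set intro!: AE_I2)+
  show "AE x in measure_pmf ?P. x \<in> ?L \<union> set_pmf ?P"
    by (simp add: AE_measure_pmf_iff)
  show "countable (?L \<union> set_pmf ?P)"
    using finite_alphabet
    by (intro countable_Un countable_set_pmf countable_SIGMA countable_lists countable_finite)
  fix z :: "'a list \<times> 'a list"
  obtain xs ys where z: "z = (xs, ys)" by force
  have "measure ?D {z} = prob (?F -` ({xs} \<times> {ys}) \<inter> space M)"
    by (simp add: measure_distr[OF F] z)
  also have "\<dots> = prob (factor X a (a + n) -` {xs} \<inter> space M) * prob (factor Y b (b + m) -` {ys} \<inter> space M)"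
    by (rule indep_varD[OF indep_factors]) auto
  also have "\<dots> = pmf ?P z"
    using prob_factor[OF indep_X prob_letters(1), of a n xs] prob_factor[OF indep_Y prob_letters(2), of b m ys]
    by (simp add: z pmf_pair vimage_def Int_def conj_commute)
  finally have "measure ?D {z} = measure (measure_pmf ?P) {z}"
    by (simp add: measure_pmf_single)
  moreover have "prob_space ?D" by (rule prob_space_distr[OF F])
  ultimately show "emeasure ?D {z} = emeasure (measure_pmf ?P) {z}"
    by (simp add: finite_measure.emeasure_eq_measure prob_space.finite_measure measure_pmf.emeasure_eq_measure)
qed simp_all

end

section \<open>Mean scores\<close>

context two_iid_words
begin

lemma expectation_factors:
  fixes f :: "'a list \<Rightarrow> 'a list \<Rightarrow> real"
  shows "expectation (\<lambda>\<omega>. f (factor X a (a + n) \<omega>) (factor Y b (b + m) \<omega>)) =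
    measure_pmf.expectation (pair_pmf (replicate_pmf n letter_law) (replicate_pmf m letter_law)) (case_prod f)"
  unfolding distr_factors[of a n b m, symmetric]
  by (subst integral_distr[OF measurable_factor_pair]) auto

lemma integrable_factors:
  fixes f :: "'a list \<Rightarrow> 'a list \<Rightarrow> real"
  shows "integrable M (\<lambda>\<omega>. f (factor X a (a + n) \<omega>) (factor Y b (b + m) \<omega>))"
proof -
  have "integrable (measure_pmf (pair_pmf (replicate_pmf n letter_law) (replicate_pmf m letter_law))) (case_prod f)"
    by (intro integrable_measure_pmf_finite) (simp add: finite_set_replicate_pmf finite_letter_law)
  then have "integrable (distr M (count_space UNIV)
      (\<lambda>\<omega>. (factor X a (a + n) \<omega>, factor Y b (b + m) \<omega>))) (case_prod f)"
    unfolding distr_factors .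
  then show ?thesis
    by (subst (asm) integrable_distr_eq[OF measurable_factor_pair]) auto
qed

lemma prob_factors:
  "prob {\<omega> \<in> space M. P (factor X a (a + n) \<omega>) (factor Y b (b + m) \<omega>)} =
    measure_pmf.prob (pair_pmf (replicate_pmf n letter_law) (replicate_pmf m letter_law)) {(x, y). P x y}"
  unfolding distr_factors[of a n b m, symmetric]
  by (subst measure_distr[OF measurable_factor_pair]) (auto intro!: arg_cong[where f = prob])

text \<open>For \<open>b = nat \<lceil>real a * p\<rceil>\<close> this is the numerator in
  \<open>gamma_tilde\<close>.\<close>

definition mean_lcs :: "nat \<Rightarrow> nat \<Rightarrow> real" where
  "mean_lcs a b = expectation (\<lambda>\<omega>. real (lcs_length (factor X 0 a \<omega>) (factor Y 0 b \<omega>)))"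

lemma mean_lcs_pmf:
  "mean_lcs n m = measure_pmf.expectation
     (pair_pmf (replicate_pmf n letter_law) (replicate_pmf m letter_law)) (\<lambda>(x, y). real (lcs_length x y))"
  using expectation_factors[of "\<lambda>x y. real (lcs_length x y)" 0 n 0 m] by (simp add: mean_lcs_def)

lemma integrable_lcs:
  "integrable M (\<lambda>\<omega>. real (lcs_length (factor X a (a + n) \<omega>) (factor Y b (b + m) \<omega>)))"
  by (rule integrable_factors)

lemma integrable_lcs_0: "integrable M (\<lambda>\<omega>. real (lcs_length (factor X 0 n \<omega>) (factor Y 0 m \<omega>)))"
  using integrable_lcs[of 0 n 0 m] by simp

lemma expectation_lcs_shift:
  "expectation (\<lambda>\<omega>. real (lcs_length (factor X a (a + n) \<omega>) (factor Y b (b + m) \<omega>))) = mean_lcs n m"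
  unfolding mean_lcs_pmf by (rule expectation_factors)

text \<open>The letters of both words have the same law, so the two words may be exchanged.\<close>

lemma mean_lcs_commute: "mean_lcs n m = mean_lcs m n"
  unfolding mean_lcs_pmf by (subst pair_commute_pmf) (simp add: case_prod_unfold lcs_length_commute)

text \<open>The pair of words is cut after \<open>a\<close> and \<open>b\<close> letters; the second
  windows have the mean score of initial words of lengths \<open>a'\<close> and
  \<open>b'\<close>.\<close>

lemma mean_lcs_superadditive: "mean_lcs a b + mean_lcs a' b' \<le> mean_lcs (a + a') (b + b')"
proof -
  have "mean_lcs a b + mean_lcs a' b' =
      expectation (\<lambda>\<omega>. real (lcs_length (factor X 0 a \<omega>) (factor Y 0 b \<omega>)) +
        real (lcs_length (factor X a (a + a') \<omega>) (factor Y b (b + b') \<omega>)))"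
    using integrable_lcs_0 integrable_lcs
    by (simp add: expectation_lcs_shift) (simp add: mean_lcs_def)
  also have "\<dots> \<le> mean_lcs (a + a') (b + b')"
    unfolding mean_lcs_def
  proof (intro integral_mono Bochner_Integration.integrable_add integrable_lcs_0 integrable_lcs)
    fix \<omega>
    show "real (lcs_length (factor X 0 a \<omega>) (factor Y 0 b \<omega>)) +
        real (lcs_length (factor X a (a + a') \<omega>) (factor Y b (b + b') \<omega>))
      \<le> real (lcs_length (factor X 0 (a + a') \<omega>) (factor Y 0 (b + b') \<omega>))"
      using factor_append[of 0 a "a + a'" X \<omega>] factor_append[of 0 b "b + b'" Y \<omega>]
        lcs_length_append[of "factor X 0 a \<omega>" "factor Y 0 b \<omega>"
          "factor X a (a + a') \<omega>" "factor Y b (b + b') \<omega>"]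
      by (simp flip: of_nat_add)
  qed
  finally show ?thesis .
qed

lemma mean_lcs_mono: "b \<le> c \<Longrightarrow> mean_lcs a b \<le> mean_lcs a c"
  unfolding mean_lcs_def
  by (intro integral_mono integrable_lcs_0)
     (simp add: factor_append[of 0 b c] lcs_length_mono subseq_rev_drop_many)

lemma mean_lcs_add_le: "mean_lcs a (b + c) \<le> mean_lcs a b + real c"
proof -
  have "mean_lcs a (b + c) \<le> expectation (\<lambda>\<omega>. real (lcs_length (factor X 0 a \<omega>) (factor Y 0 b \<omega>)) + real c)"
    unfolding mean_lcs_def
  proof (intro integral_mono Bochner_Integration.integrable_add integrable_lcs_0)
    fix \<omega>
    show "real (lcs_length (factor X 0 a \<omega>) (factor Y 0 (b + c) \<omega>))
        \<le> real (lcs_length (factor X 0 a \<omega>) (factor Y 0 b \<omega>)) + real c"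
      using lcs_length_insert_le[of "factor Y 0 b \<omega>" "factor Y b (b + c) \<omega>" "[]" "factor X 0 a \<omega>"]
        factor_append[of 0 b "b + c" Y \<omega>]
      by (simp add: lcs_length_commute flip: of_nat_add)
  qed simp
  also have "\<dots> = mean_lcs a b + real c"
    using integrable_lcs_0 by (simp add: mean_lcs_def prob_space)
  finally show ?thesis .
qed

text \<open>Each additional letter is worth at most 1; this controls the rounding errors
  below.\<close>

lemma mean_lcs_Lipschitz: "mean_lcs a b \<le> mean_lcs a c + \<bar>real b - real c\<bar>"
proof (cases "b \<le> c")
  case True
  then show ?thesis using mean_lcs_mono[OF True, of a] by simp
next
  case False
  then show ?thesis using mean_lcs_add_le[of a c "b - c"] by simp
qed

lemma mean_lcs_le: "mean_lcs a b \<le> real a"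
proof -
  have "mean_lcs a b \<le> expectation (\<lambda>\<omega>. real a)"
    unfolding mean_lcs_def
  proof (intro integral_mono integrable_lcs_0)
    fix \<omega>
    show "real (lcs_length (factor X 0 a \<omega>) (factor Y 0 b \<omega>)) \<le> real a"
      using lcs_length_le_length[of "factor X 0 a \<omega>" "factor Y 0 b \<omega>"] by simp
  qed simp
  then show ?thesis by (simp add: prob_space)
qed

lemma mean_lcs_0 [simp]: "mean_lcs 0 b = 0"
proof -
  have "lcs_length (factor X 0 0 \<omega>) (factor Y 0 b \<omega>) = 0" for \<omega>
    using lcs_length_le_length[of "factor X 0 0 \<omega>" "factor Y 0 b \<omega>"] by simp
  then show ?thesis by (simp add: mean_lcs_def)
qed

lemma mean_lcs_mult: "real j * mean_lcs a b \<le> mean_lcs (j * a) (j * b)"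
proof (induction j)
  case (Suc j)
  then show ?case
    using mean_lcs_superadditive[of a b "j * a" "j * b"] by (simp add: algebra_simps)
qed simp

section \<open>Limits of mean scores and bounds by the limit constants\<close>

lemma gamma_tilde_limit:
  assumes "p > 0"
  shows "(\<lambda>n. mean_lcs n (nat \<lceil>real n * p\<rceil>) / real n) \<longlonglongrightarrow> gamma_tilde M X Y p * ((1 + p) / 2)"
proof -
  let ?u = "\<lambda>n. mean_lcs n (nat \<lceil>real n * p\<rceil>)"
  have "convergent (\<lambda>n. ?u n / real n)"
  \<comment> \<open>The sum of two rounded lengths exceeds the rounded sum by at most one letter,
    worth at most 1, whence \<open>c = 1\<close>; \<open>C = 1\<close> since the score is at most
    \<open>n\<close>.\<close>
  proof (rule superadditive_convergent[where c = 1 and C = 1])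
    fix m n
    have "0 \<le> real m * p" "0 \<le> real n * p" using assms by auto
    then have "nat \<lceil>real m * p\<rceil> + nat \<lceil>real n * p\<rceil> \<le> nat \<lceil>real m * p + real n * p\<rceil> + 1"
      "nat \<lceil>real m * p + real n * p\<rceil> \<le> nat \<lceil>real m * p\<rceil> + nat \<lceil>real n * p\<rceil>"
      by linarith+
    then have "\<bar>real (nat \<lceil>real m * p\<rceil> + nat \<lceil>real n * p\<rceil>) - real (nat \<lceil>real (m + n) * p\<rceil>)\<bar> \<le> 1"
      unfolding of_nat_add distrib_right by linarith
    then show "?u m + ?u n - 1 \<le> ?u (m + n)"
      using mean_lcs_superadditive[of m "nat \<lceil>real m * p\<rceil>" n "nat \<lceil>real n * p\<rceil>"]
        mean_lcs_Lipschitz[of "m + n" "nat \<lceil>real m * p\<rceil> + nat \<lceil>real n * p\<rceil>" "nat \<lceil>real (m + n) * p\<rceil>"]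
      by linarith
  qed (use mean_lcs_le in simp)
  then obtain L where L: "(\<lambda>n. ?u n / real n) \<longlonglongrightarrow> L"
    by (auto simp: convergent_def)
  then have "(\<lambda>n. ?u n / real n / ((1 + p) / 2)) \<longlonglongrightarrow> L / ((1 + p) / 2)"
    using assms by (intro tendsto_divide tendsto_const) auto
  then have "gamma_tilde M X Y p = L / ((1 + p) / 2)"
    unfolding gamma_tilde_def mean_lcs_def[symmetric] by (intro limI) (simp add: divide_divide_eq_left mult.assoc)
  then show ?thesis using L assms by simp
qed

lemma gamma_star_limit: "(\<lambda>n. mean_lcs n n / real n) \<longlonglongrightarrow> gamma_star M X Y"
  using gamma_tilde_limit[of 1] by (simp add: gamma_tilde_1)

text \<open>Concatenating \<open>j\<close> pairs of words of lengths \<open>(a, b)\<close> with about \<open>\<tau> j\<close> pairs of lengths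
  \<open>(b, a)\<close> gives a pair of words whose lengths are in the ratio \<open>p\<close> up to a bounded error.\<close>

lemma mean_lcs_le_gamma_tilde:
  assumes "p > 0" "\<tau> \<ge> 0" "a \<ge> 1"
    and ratio: "real b + \<tau> * real a = p * (real a + \<tau> * real b)"
  shows "mean_lcs a b \<le> gamma_tilde M X Y p * ((real a + real b) / 2)"
proof -
  let ?u = "\<lambda>n. mean_lcs n (nat \<lceil>real n * p\<rceil>)"
  let ?g = "gamma_tilde M X Y p * ((1 + p) / 2)"
  \<comment> \<open>The number of swapped pairs, \<open>\<tau> j\<close> rounded down;
    \<open>N j\<close> is then the length of the first concatenated word.\<close>
  define t where "t j = nat \<lfloor>real j * \<tau>\<rfloor>" for j
  define N where "N j = j * a + t j * b" for j
  \<comment> \<open>Rounding \<open>\<tau> j\<close> shifts the second length by at most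
    \<open>\<bar>a - p b\<bar>\<close>, and rounding up \<open>N j * p\<close> by at most 1.\<close>
  define K where "K = \<bar>real a - p * real b\<bar> + 1"
  have t: "real j * \<tau> - 1 \<le> real (t j)" "real (t j) \<le> real j * \<tau>" for j
  proof -
    have "0 \<le> real j * \<tau>" using assms by simp
    then show "real j * \<tau> - 1 \<le> real (t j)" "real (t j) \<le> real j * \<tau>"
      unfolding t_def by linarith+
  qed
  have main: "(real j + real (t j)) * mean_lcs a b \<le> ?u (N j) + K" for j
  proof -
    have "(real j + real (t j)) * mean_lcs a b = real j * mean_lcs a b + real (t j) * mean_lcs b a"
      by (simp add: distrib_right mean_lcs_commute[of b a])
    also have "\<dots> \<le> mean_lcs (j * a) (j * b) + mean_lcs (t j * b) (t j * a)"
      by (intro add_mono mean_lcs_mult)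
    also have "\<dots> \<le> mean_lcs (N j) (j * b + t j * a)"
      unfolding N_def by (rule mean_lcs_superadditive)
    also have "\<dots> \<le> ?u (N j) + \<bar>real (j * b + t j * a) - real (nat \<lceil>real (N j) * p\<rceil>)\<bar>"
      by (rule mean_lcs_Lipschitz)
    also have "\<bar>real (j * b + t j * a) - real (nat \<lceil>real (N j) * p\<rceil>)\<bar> \<le> K"
    proof -
      have "real (j * b + t j * a) - real (N j) * p
          = real j * (real b - p * real a) + real (t j) * (real a - p * real b)"
        by (simp add: N_def algebra_simps)
      \<comment> \<open>By the choice of \<open>\<tau>\<close> the two errors cancel except for the
        rounding of \<open>\<tau> j\<close>.\<close>
      also have "real b - p * real a = - \<tau> * (real a - p * real b)"
        using ratio by (simp add: algebra_simps)
      finally have "real (j * b + t j * a) - real (N j) * p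
          = (real (t j) - real j * \<tau>) * (real a - p * real b)"
        by (simp add: algebra_simps)
      also have "\<bar>\<dots>\<bar> \<le> 1 * \<bar>real a - p * real b\<bar>"
        unfolding abs_mult using t[of j] by (intro mult_right_mono) auto
      finally have "\<bar>real (j * b + t j * a) - real (N j) * p\<bar> \<le> \<bar>real a - p * real b\<bar>" by simp
      moreover have "0 \<le> real (N j) * p" using assms by simp
      ultimately show ?thesis unfolding K_def by linarith
    qed
    finally show ?thesis by simp
  qed
  have t_lim: "(\<lambda>j. real (t j) / real j) \<longlonglongrightarrow> \<tau>"
  proof (rule tendsto_sandwich)
    show "(\<lambda>j. \<tau> - 1 / real j) \<longlonglongrightarrow> \<tau>"
      using tendsto_diff[OF tendsto_const[of \<tau>] lim_const_over_n[of 1]] by simp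
    show "\<forall>\<^sub>F j in sequentially. \<tau> - 1 / real j \<le> real (t j) / real j"
      using eventually_gt_at_top[of 0]
    proof eventually_elim
      case (elim j)
      then show ?case using divide_right_mono[OF t(1)[of j], of "real j"] by (simp add: diff_divide_distrib)
    qed
    show "\<forall>\<^sub>F j in sequentially. real (t j) / real j \<le> \<tau>"
      using eventually_gt_at_top[of 0]
    proof eventually_elim
      case (elim j)
      then show ?case using divide_right_mono[OF t(2)[of j], of "real j"] by simp
    qed
  qed simp
  have N_lim: "(\<lambda>j. real (N j) / real j) \<longlonglongrightarrow> real a + \<tau> * real b"
  proof (rule Lim_transform_eventually)
    show "(\<lambda>j. real a + real (t j) / real j * real b) \<longlonglongrightarrow> real a + \<tau> * real b"
      by (intro tendsto_intros t_lim)
    show "\<forall>\<^sub>F j in sequentially. real a + real (t j) / real j * real b = real (N j) / real j"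
      using eventually_gt_at_top[of 0] by eventually_elim (simp add: N_def field_simps)
  qed
  have N_ge: "j \<le> N j" for j
  proof -
    have "j * 1 \<le> j * a" using assms by (intro mult_le_mono2) auto
    then show ?thesis unfolding N_def by linarith
  qed
  have "filterlim N at_top sequentially"
    by (rule filterlim_at_top_mono[OF filterlim_ident]) (simp add: N_ge)
  with gamma_tilde_limit[OF \<open>p > 0\<close>] have u_lim: "(\<lambda>j. ?u (N j) / real (N j)) \<longlonglongrightarrow> ?g"
    by (rule filterlim_compose)
  have "(1 + \<tau>) * mean_lcs a b \<le> ?g * (real a + \<tau> * real b) + 0"
  proof (rule tendsto_le[OF sequentially_bot])
    show "(\<lambda>j. ?u (N j) / real (N j) * (real (N j) / real j) + K / real j)
        \<longlonglongrightarrow> ?g * (real a + \<tau> * real b) + 0"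
      by (intro tendsto_intros u_lim N_lim lim_const_over_n)
    show "(\<lambda>j. (1 + real (t j) / real j) * mean_lcs a b) \<longlonglongrightarrow> (1 + \<tau>) * mean_lcs a b"
      by (intro tendsto_intros t_lim)
    show "\<forall>\<^sub>F j in sequentially. (1 + real (t j) / real j) * mean_lcs a b
        \<le> ?u (N j) / real (N j) * (real (N j) / real j) + K / real j"
      using eventually_gt_at_top[of 0]
    proof eventually_elim
      case (elim j)
      have "(1 + real (t j) / real j) * mean_lcs a b = (real j + real (t j)) * mean_lcs a b / real j"
        using elim by (simp add: field_simps)
      also have "\<dots> \<le> (?u (N j) + K) / real j"
        by (intro divide_right_mono main) simp
      also have "\<dots> = ?u (N j) / real (N j) * (real (N j) / real j) + K / real j"
        using elim N_ge[of j] by (simp add: add_divide_distrib)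
      finally show ?case .
    qed
  qed
  also have "?g * (real a + \<tau> * real b) + 0
      = (1 + \<tau>) * (gamma_tilde M X Y p * ((real a + real b) / 2))"
  proof -
    \<comment> \<open>Adding \<open>a + \<tau> b\<close> to both sides of \<open>ratio\<close> gives
      this identity, after which \<open>1 + \<tau>\<close> cancels.\<close>
    have "(1 + p) * (real a + \<tau> * real b) = (1 + \<tau>) * (real a + real b)"
      using ratio by (simp add: algebra_simps)
    then show ?thesis by (simp add: mult.assoc mult.left_commute)
  qed
  finally show ?thesis
    using \<open>\<tau> \<ge> 0\<close> by simp
qed

lemma mean_lcs_le_gamma_star:
  assumes "a \<ge> 1"
  shows "mean_lcs a b \<le> gamma_star M X Y * ((real a + real b) / 2)"
  using mean_lcs_le_gamma_tilde[of 1 1 a b] assms by (simp add: gamma_tilde_1 algebra_simps)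

text \<open>This \<open>\<tau>\<close> solves the ratio equation; its denominator is positive
  because \<open>b p \<le> b < a p < a\<close>.\<close>

lemma mean_lcs_le_gamma_tilde_below:
  assumes "0 < p" "p < 1" "a \<ge> 1" "real b < real a * p"
  shows "mean_lcs a b \<le> gamma_tilde M X Y p * ((real a + real b) / 2)"
proof (rule mean_lcs_le_gamma_tilde[where \<tau> = "(real a * p - real b) / (real a - real b * p)"])
  have "real b * p \<le> real b * 1" using assms by (intro mult_left_mono) auto
  moreover have "real a * p < real a * 1" using assms by (intro mult_strict_left_mono) auto
  ultimately have "0 < real a - real b * p" using assms by linarith
  then show "0 \<le> (real a * p - real b) / (real a - real b * p)"
    "real b + (real a * p - real b) / (real a - real b * p) * real a =
      p * (real a + (real a * p - real b) / (real a - real b * p) * real b)"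
    using assms by (auto simp: field_simps)
qed (use assms in auto)

text \<open>The same solution with both signs reversed; here
  \<open>b p \<ge> b > a p > a\<close>.\<close>

lemma mean_lcs_le_gamma_tilde_above:
  assumes "1 < p" "a \<ge> 1" "real a * p < real b"
  shows "mean_lcs a b \<le> gamma_tilde M X Y p * ((real a + real b) / 2)"
proof (rule mean_lcs_le_gamma_tilde[where \<tau> = "(real b - real a * p) / (real b * p - real a)"])
  have "real b * 1 \<le> real b * p" using assms by (intro mult_left_mono) auto
  moreover have "real a * 1 < real a * p" using assms by (intro mult_strict_left_mono) auto
  ultimately have "0 < real b * p - real a" using assms by linarith
  then show "0 \<le> (real b - real a * p) / (real b * p - real a)"
    "real b + (real b - real a * p) / (real b * p - real a) * real a =
      p * (real a + (real b - real a * p) / (real b * p - real a) * real b)"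
    using assms by (auto simp: field_simps)
qed (use assms in auto)

text \<open>Each block contributes at most \<open>gamma_star\<close> times half its two lengths. At
  least \<open>\<epsilon> m\<close> blocks have a length outside the range, and each of those loses
  a further \<open>d k / 2\<close>.\<close>

lemma sum_mean_lcs_le:
  assumes cut: "cut_vector (k * m) m r" and "k \<ge> 1" "0 < p1" "p1 < 1" "1 < p2" "0 \<le> d"
    and d1: "gamma_tilde M X Y p1 \<le> gamma_star M X Y - d"
    and d2: "gamma_tilde M X Y p2 \<le> gamma_star M X Y - d"
    and bad: "real (card {i \<in> {1..m}. real k * p1 \<le> real (r i) - real (r (i - 1)) \<and>
                real (r i) - real (r (i - 1)) \<le> real k * p2}) \<le> (1 - \<epsilon>) * real m"
  shows "(\<Sum>i = 1..m. mean_lcs k (r i - r (i - 1)))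
    \<le> gamma_star M X Y * real (k * m) - d * \<epsilon> * real (k * m) / 2"
proof -
  let ?good = "{i \<in> {1..m}. real k * p1 \<le> real (r i) - real (r (i - 1)) \<and>
                real (r i) - real (r (i - 1)) \<le> real k * p2}"
  have r_diff: "real (r i - r (i - 1)) = real (r i) - real (r (i - 1))" if "i \<in> {1..m}" for i
    using cut that by (subst of_nat_diff) (auto simp: cut_vector_def intro: less_imp_le)
  have "(\<Sum>i = 1..m. mean_lcs k (r i - r (i - 1)))
      \<le> (\<Sum>i = 1..m. gamma_star M X Y * ((real k + (real (r i) - real (r (i - 1)))) / 2)
            - (if i \<in> ?good then 0 else d * real k / 2))"
  proof (rule sum_mono)
    fix i assume i: "i \<in> {1..m}"
    let ?q = "r i - r (i - 1)"
    show "mean_lcs k ?q \<le> gamma_star M X Y * ((real k + (real (r i) - real (r (i - 1)))) / 2)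
            - (if i \<in> ?good then 0 else d * real k / 2)"
    proof (cases "i \<in> ?good")
      case True
      then show ?thesis
        using mean_lcs_le_gamma_star[OF \<open>k \<ge> 1\<close>, of ?q] unfolding if_P[OF True] r_diff[OF i] by simp
    next
      case False
      then have "real ?q < real k * p1 \<or> real k * p2 < real ?q"
        using i unfolding r_diff[OF i] by auto
      then have "mean_lcs k ?q \<le> (gamma_star M X Y - d) * ((real k + real ?q) / 2)"
      proof
        assume "real ?q < real k * p1"
        then have "mean_lcs k ?q \<le> gamma_tilde M X Y p1 * ((real k + real ?q) / 2)"
          using assms by (intro mean_lcs_le_gamma_tilde_below) auto
        also have "\<dots> \<le> (gamma_star M X Y - d) * ((real k + real ?q) / 2)"
          using d1 by (intro mult_right_mono) auto
        finally show ?thesis .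
      next
        assume "real k * p2 < real ?q"
        then have "mean_lcs k ?q \<le> gamma_tilde M X Y p2 * ((real k + real ?q) / 2)"
          using assms by (intro mean_lcs_le_gamma_tilde_above) auto
        also have "\<dots> \<le> (gamma_star M X Y - d) * ((real k + real ?q) / 2)"
          using d2 by (intro mult_right_mono) auto
        finally show ?thesis .
      qed
      \<comment> \<open>Discarding the length \<open>?q\<close> leaves a loss that is the same for
        all bad blocks.\<close>
      moreover have "d * (real k / 2) \<le> d * ((real k + real ?q) / 2)"
        using \<open>0 \<le> d\<close> by (intro mult_left_mono) auto
      ultimately show ?thesis
        unfolding if_not_P[OF False] r_diff[OF i] left_diff_distrib by simp
    qed
  qed
  also have "\<dots> = gamma_star M X Y * ((\<Sum>i = 1..m. real k + (real (r i) - real (r (i - 1)))) / 2)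
      - (\<Sum>i = 1..m. if i \<in> ?good then 0 else d * real k / 2)"
    by (simp add: sum_subtractf sum_distrib_left sum_divide_distrib)
  also have "(\<Sum>i = 1..m. real k + (real (r i) - real (r (i - 1)))) = 2 * real (k * m)"
    using sum_telescope''[of 0 m "\<lambda>i. real (r i)"] cut by (simp add: sum.distrib cut_vector_def)
  also have "(\<Sum>i = 1..m. if i \<in> ?good then 0 else d * real k / 2)
      = real (card ({1..m} - ?good)) * (d * real k / 2)"
    by (simp add: sum.If_cases Diff_eq[symmetric] del: mem_Collect_eq Collect_mem_eq)
  also have "real (card ({1..m} - ?good)) = real m - real (card ?good)"
  proof -
    have "card ?good \<le> card {1..m}" by (rule card_mono) auto
    then show ?thesis by (subst card_Diff_subset) (auto simp del: One_nat_def intro!: of_nat_diff)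
  qed
  also have "gamma_star M X Y * (2 * real (k * m) / 2) - (real m - real (card ?good)) * (d * real k / 2)
      \<le> gamma_star M X Y * real (k * m) - (\<epsilon> * real m) * (d * real k / 2)"
    using bad \<open>0 \<le> d\<close> by (intro diff_mono mult_right_mono) (auto simp: algebra_simps)
  finally show ?thesis by (simp add: mult_ac)
qed

end

section \<open>Deviation of the score of a cut vector\<close>

text \<open>Turns the two words into one word of iid letters, the form in which McDiarmid's
  inequality is stated.\<close>

lemma replicate_pmf_add:
  "map_pmf (\<lambda>w. (take n w, drop n w)) (replicate_pmf (n + m) p) =
     pair_pmf (replicate_pmf n p) (replicate_pmf m p)"
  unfolding replicate_pmf_distrib pair_pmf_def map_bind_pmf
  by (intro bind_pmf_cong refl) (auto simp: set_replicate_pmf)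

lemma take_drop_update:
  assumes "j < length w"
  shows "take n (w[j := c]) = (take n w)[j := c] \<and> drop n (w[j := c]) = drop n w \<or>
    take n (w[j := c]) = take n w \<and> drop n (w[j := c]) = (drop n w)[j - n := c]"
  by (cases "j < n") (simp_all add: take_update_swap drop_update_swap list_update_beyond)

text \<open>It vanishes exactly when the cuts attain the score of the whole words.\<close>

definition lcs_deficit :: "nat \<Rightarrow> (nat \<Rightarrow> nat) \<Rightarrow> (nat \<Rightarrow> nat) \<Rightarrow> 'a list \<Rightarrow> 'a list \<Rightarrow> real" where
  "lcs_deficit m s r x y = real (lcs_length x y) - real (blocks_lcs m s r x y)"

text \<open>Both terms of the difference move by at most 1, whence the constant 2.\<close>

lemma lcs_deficit_update:
  assumes "\<And>i. i \<in> {1..m} \<Longrightarrow> s (i - 1) \<le> s i" "\<And>i. i \<in> {1..m} \<Longrightarrow> r (i - 1) \<le> r i"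
  shows "\<bar>lcs_deficit m s r (x[j := c]) y - lcs_deficit m s r x y\<bar> \<le> 2"
    and "\<bar>lcs_deficit m s r x (y[j := c]) - lcs_deficit m s r x y\<bar> \<le> 2"
proof -
  show "\<bar>lcs_deficit m s r (x[j := c]) y - lcs_deficit m s r x y\<bar> \<le> 2"
    using blocks_lcs_update_left[of m s r x j c y] lcs_length_update[of x j c y] assms(1)
    unfolding lcs_deficit_def by fastforce
  show "\<bar>lcs_deficit m s r x (y[j := c]) - lcs_deficit m s r x y\<bar> \<le> 2"
    using blocks_lcs_update_right[of m r s x y j c] lcs_length_update[of y j c x] assms(2)
    unfolding lcs_deficit_def lcs_length_commute[of x] by fastforce
qed

context two_iid_words
begin

lemma blocks_lcs_factors:
  assumes "cut_vector n m s" "cut_vector n m r"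
  shows "blocks_lcs m s r (factor X 0 n \<omega>) (factor Y 0 n \<omega>) =
    (\<Sum>i = 1..m. lcs_length (factor X (s (i - 1)) (s i) \<omega>) (factor Y (r (i - 1)) (r i) \<omega>))"
  unfolding blocks_lcs_def
proof (rule sum.cong[OF refl])
  fix i assume i: "i \<in> {1..m}"
  have le: "q (i - 1) \<le> q i" "q i \<le> n" if "cut_vector n m q" for q
    using i that cut_vector_le[OF that, of i] by (auto simp: cut_vector_def less_imp_le)
  show "lcs_length (drop (s (i - 1)) (take (s i) (factor X 0 n \<omega>)))
      (drop (r (i - 1)) (take (r i) (factor Y 0 n \<omega>))) =
    lcs_length (factor X (s (i - 1)) (s i) \<omega>) (factor Y (r (i - 1)) (r i) \<omega>)"
    using factor_eq_drop_take[OF le[OF assms(1)], of X \<omega>] factor_eq_drop_take[OF le[OF assms(2)], of Y \<omega>]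
    by simp
qed

lemma expectation_lcs_deficit:
  assumes "cut_vector n m s" "cut_vector n m r"
  shows "expectation (\<lambda>\<omega>. lcs_deficit m s r (factor X 0 n \<omega>) (factor Y 0 n \<omega>)) =
    mean_lcs n n - (\<Sum>i = 1..m. mean_lcs (s i - s (i - 1)) (r i - r (i - 1)))"
proof -
  let ?h = "\<lambda>i \<omega>. real (lcs_length (factor X (s (i - 1)) (s i) \<omega>) (factor Y (r (i - 1)) (r i) \<omega>))"
  have h: "integrable M (?h i)" "expectation (?h i) = mean_lcs (s i - s (i - 1)) (r i - r (i - 1))"
    if i: "i \<in> {1..m}" for i
  proof -
    have "s i = s (i - 1) + (s i - s (i - 1))" "r i = r (i - 1) + (r i - r (i - 1))"
      using i assms by (auto simp: cut_vector_def less_imp_le)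
    then show "integrable M (?h i)" "expectation (?h i) = mean_lcs (s i - s (i - 1)) (r i - r (i - 1))"
      using integrable_lcs[of "s (i - 1)" "s i - s (i - 1)" "r (i - 1)" "r i - r (i - 1)"]
        expectation_lcs_shift[of "s (i - 1)" "s i - s (i - 1)" "r (i - 1)" "r i - r (i - 1)"]
      by auto
  qed
  have "expectation (\<lambda>\<omega>. lcs_deficit m s r (factor X 0 n \<omega>) (factor Y 0 n \<omega>)) =
      expectation (\<lambda>\<omega>. real (lcs_length (factor X 0 n \<omega>) (factor Y 0 n \<omega>)) - (\<Sum>i = 1..m. ?h i \<omega>))"
    by (simp only: lcs_deficit_def blocks_lcs_factors[OF assms] of_nat_sum)
  also have "\<dots> = mean_lcs n n - (\<Sum>i = 1..m. expectation (?h i))"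
    using h(1) integrable_lcs_0[of n n]
    by (subst Bochner_Integration.integral_diff)
       (auto simp: mean_lcs_def Bochner_Integration.integral_sum simp del: One_nat_def)
  also have "\<dots> = mean_lcs n n - (\<Sum>i = 1..m. mean_lcs (s i - s (i - 1)) (r i - r (i - 1)))"
    by (simp only: h(2) cong: sum.cong)
  finally show ?thesis .
qed

text \<open>McDiarmid's inequality for \<open>2 n\<close> letters with difference bound 2 has the
  exponent \<open>2 t\<^sup>2 / (2 n * 4) = t\<^sup>2 / (4 n)\<close>.\<close>

lemma prob_lcs_deficit_le:
  assumes s: "cut_vector n m s" and r: "cut_vector n m r" and "n > 0" "t > 0"
    and mean: "t \<le> expectation (\<lambda>\<omega>. lcs_deficit m s r (factor X 0 n \<omega>) (factor Y 0 n \<omega>))"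
  shows "prob {\<omega> \<in> space M. lcs_deficit m s r (factor X 0 n \<omega>) (factor Y 0 n \<omega>) \<le> 0}
    \<le> exp (- t\<^sup>2 / (4 * real n))"
proof -
  let ?D = "lcs_deficit m s r"
  let ?R = "replicate_pmf (n + n) letter_law"
  let ?f = "\<lambda>w. ?D (take n w) (drop n w)"
  note split = replicate_pmf_add[of n n letter_law, symmetric]
  have E: "expectation (\<lambda>\<omega>. ?D (factor X 0 n \<omega>) (factor Y 0 n \<omega>)) = measure_pmf.expectation ?R ?f"
    using expectation_factors[of ?D 0 n 0 n] unfolding split by simp
  have "prob {\<omega> \<in> space M. ?D (factor X 0 n \<omega>) (factor Y 0 n \<omega>) \<le> 0} = measure_pmf.prob ?R {w. ?f w \<le> 0}"
    using prob_factors[of "\<lambda>x y. ?D x y \<le> 0" 0 n 0 n] unfolding split by (simp add: vimage_def)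
  \<comment> \<open>The mean is at least \<open>t\<close>, so a deficit of at most 0 lies at least
    \<open>t\<close> below it.\<close>
  also have "\<dots> \<le> measure_pmf.prob ?R {w. ?f w \<le> measure_pmf.expectation ?R ?f - t}"
    using mean unfolding E by (intro measure_pmf.finite_measure_mono) auto
  also have "\<dots> \<le> exp (- 2 * t\<^sup>2 / (real (n + n) * 2\<^sup>2))"
  proof (rule McDiarmid_le[OF finite_letter_law])
    fix w :: "'a list" and j a assume "length w = n + n" "j < n + n"
    then have "j < length w" by simp
    have update: "\<bar>?D (x[i := c]) y - ?D x y\<bar> \<le> 2" "\<bar>?D x (y[i := c]) - ?D x y\<bar> \<le> 2"
      for x y :: "'a list" and i c
      by (rule lcs_deficit_update; use s r in \<open>auto simp: cut_vector_def less_imp_le\<close>)+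
    show "\<bar>?f (w[j := a]) - ?f w\<bar> \<le> 2"
      using take_drop_update[OF \<open>j < length w\<close>, of n a] by (auto simp: update)
  qed (use assms in auto)
  also have "- 2 * t\<^sup>2 / (real (n + n) * 2\<^sup>2) = - t\<^sup>2 / (4 * real n)"
    using \<open>n > 0\<close> by (simp add: field_simps)
  finally show ?thesis .
qed

section \<open>Union bound over the cut vectors violating the diagonal condition\<close>

lemma cut_vector_equidistant:
  assumes "k \<ge> 1"
  shows "cut_vector (k * m) m (\<lambda>i. k * i)"
  using assms by (auto simp: cut_vector_def)

definition bad_cuts :: "nat \<Rightarrow> nat \<Rightarrow> real \<Rightarrow> real \<Rightarrow> real \<Rightarrow> (nat \<Rightarrow> nat) set" where
  "bad_cuts k m \<epsilon> p1 p2 = {r \<in> cut_vectors (k * m) m.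
     real (card {i \<in> {1..m}. real k * p1 \<le> real (r i) - real (r (i - 1)) \<and>
       real (r i) - real (r (i - 1)) \<le> real k * p2}) < (1 - \<epsilon>) * real m}"

text \<open>Writes the complement as a finite union of events about the two words, which yields
  measurability and the union bound.\<close>

lemma diagonal_event_eq:
  assumes "k \<ge> 1"
  shows "diagonal_event M X Y k m \<epsilon> p1 p2 = space M - (\<Union>r\<in>bad_cuts k m \<epsilon> p1 p2.
    {\<omega> \<in> space M. lcs_deficit m (\<lambda>i. k * i) r (factor X 0 (k * m) \<omega>) (factor Y 0 (k * m) \<omega>) = 0})"
    (is "?L = ?R")
proof -
  let ?good = "\<lambda>r. real (card {i \<in> {1..m}. real k * p1 \<le> real (r i) - real (r (i - 1)) \<and>
       real (r i) - real (r (i - 1)) \<le> real k * p2})"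
  let ?S = "\<lambda>r \<omega>. \<Sum>i = 1..m. lcs_length (factor X (k * (i - 1)) (k * i) \<omega>) (factor Y (r (i - 1)) (r i) \<omega>)"
  let ?D = "\<lambda>r \<omega>. lcs_deficit m (\<lambda>i. k * i) r (factor X 0 (k * m) \<omega>) (factor Y 0 (k * m) \<omega>)"
  have D: "?D r \<omega> = 0 \<longleftrightarrow> LC X Y (k * m) \<omega> = ?S r \<omega>" if "cut_vector (k * m) m r" for r \<omega>
    using blocks_lcs_factors[OF cut_vector_equidistant[OF assms] that, of \<omega>]
    by (simp add: lcs_deficit_def LC_def del: of_nat_sum)
  \<comment> \<open>The event quantifies over all functions \<open>r\<close>, but only the values on
    \<open>{0..m}\<close> matter, so each \<open>r\<close> can be replaced by its representative in
    \<open>cut_vectors\<close>.\<close>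
  have restrict: "cut_vector (k * m) m (restrict r {0..m}) = cut_vector (k * m) m r"
    "?good (restrict r {0..m}) = ?good r" "?S (restrict r {0..m}) \<omega> = ?S r \<omega>" for r \<omega>
    by (auto simp: cut_vector_def intro!: arg_cong[where f = card] sum.cong)
  show ?thesis
  proof (intro set_eqI iffI)
    fix \<omega> assume \<omega>: "\<omega> \<in> ?L"
    then have "?D r \<omega> \<noteq> 0" if "r \<in> bad_cuts k m \<epsilon> p1 p2" for r
      using that D[of r \<omega>] by (force simp: diagonal_event_def bad_cuts_def cut_vectors_def)
    with \<omega> show "\<omega> \<in> ?R" by (auto simp: diagonal_event_def)
  next
    fix \<omega> assume \<omega>: "\<omega> \<in> ?R"
    have "(1 - \<epsilon>) * real m \<le> ?good r" if r: "cut_vector (k * m) m r" "LC X Y (k * m) \<omega> = ?S r \<omega>" for r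
    proof (rule ccontr)
      assume "\<not> ?thesis"
      with r have "restrict r {0..m} \<in> bad_cuts k m \<epsilon> p1 p2"
        unfolding bad_cuts_def cut_vectors_def mem_Collect_eq restrict by auto
      moreover have "?D (restrict r {0..m}) \<omega> = 0"
        using r D[of "restrict r {0..m}" \<omega>] unfolding restrict by simp
      ultimately show False using \<omega> by auto
    qed
    with \<omega> show "\<omega> \<in> ?L" by (auto simp: diagonal_event_def)
  qed
qed

lemma measurable_factors_set:
  "{\<omega> \<in> space M. P (factor X 0 n \<omega>) (factor Y 0 n \<omega>)} \<in> sets M"
proof -
  have "(\<lambda>\<omega>. (factor X 0 n \<omega>, factor Y 0 n \<omega>)) -` {(x, y). P x y} \<inter> space M \<in> sets M"
    by (rule measurable_sets[OF measurable_factor_pair]) simp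
  also have "(\<lambda>\<omega>. (factor X 0 n \<omega>, factor Y 0 n \<omega>)) -` {(x, y). P x y} \<inter> space M =
      {\<omega> \<in> space M. P (factor X 0 n \<omega>) (factor Y 0 n \<omega>)}"
    by auto
  finally show ?thesis .
qed

lemma prob_diagonal_event_ge:
  assumes "k \<ge> 1" "m \<ge> 1"
    and small: "\<And>r. r \<in> bad_cuts k m \<epsilon> p1 p2 \<Longrightarrow>
      prob {\<omega> \<in> space M. lcs_deficit m (\<lambda>i. k * i) r (factor X 0 (k * m) \<omega>) (factor Y 0 (k * m) \<omega>) \<le> 0}
        \<le> exp (- real (k * m) * c)"
  shows "1 - exp (- real (k * m) * (- ((1 + ln (real k)) / real k) + c))
    \<le> prob (diagonal_event M X Y k m \<epsilon> p1 p2)"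
proof -
  let ?D = "\<lambda>r \<omega>. lcs_deficit m (\<lambda>i. k * i) r (factor X 0 (k * m) \<omega>) (factor Y 0 (k * m) \<omega>)"
  let ?B = "bad_cuts k m \<epsilon> p1 p2" and ?F = "\<lambda>r. {\<omega> \<in> space M. ?D r \<omega> = 0}"
  have B: "?B \<subseteq> cut_vectors (k * m) m" by (auto simp: bad_cuts_def)
  have finB: "finite ?B" by (rule finite_subset[OF B finite_cut_vectors])
  have F: "?F r \<in> sets M" for r by (rule measurable_factors_set)
  have "prob (\<Union>r\<in>?B. ?F r) \<le> (\<Sum>r\<in>?B. prob (?F r))"
    using finB F by (intro finite_measure_subadditive_finite) auto
  also have "\<dots> \<le> (\<Sum>r\<in>?B. exp (- real (k * m) * c))"
  proof (rule sum_mono)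
    fix r assume r: "r \<in> ?B"
    have "prob (?F r) \<le> prob {\<omega> \<in> space M. ?D r \<omega> \<le> 0}"
      by (intro finite_measure_mono measurable_factors_set) auto
    with small[OF r] show "prob (?F r) \<le> exp (- real (k * m) * c)" by linarith
  qed
  also have "\<dots> = real (card ?B) * exp (- real (k * m) * c)" by simp
  also have "\<dots> \<le> (exp 1 * real k) ^ m * exp (- real (k * m) * c)"
  proof (rule mult_right_mono)
    have "card ?B \<le> k * m choose m"
      using card_mono[OF finite_cut_vectors B] card_cut_vectors_le[of "k * m" m] by linarith
    then show "real (card ?B) \<le> (exp 1 * real k) ^ m"
      using binomial_le_exp_power[of k m] by linarith
  qed simp
  \<comment> \<open>With \<open>n = k m\<close> the count becomes
    \<open>exp (n * (1 + ln k) / k)\<close>, the entropy term of the exponent.\<close>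
  also have "(exp 1 * real k) ^ m = exp (real m * (1 + ln (real k)))"
    using \<open>k \<ge> 1\<close> by (simp add: exp_of_nat_mult exp_add)
  also have "\<dots> * exp (- real (k * m) * c) =
      exp (- real (k * m) * (- ((1 + ln (real k)) / real k) + c))"
    using \<open>k \<ge> 1\<close> unfolding exp_add[symmetric] by (simp add: field_simps)
  finally have "prob (\<Union>r\<in>?B. ?F r) \<le> exp (- real (k * m) * (- ((1 + ln (real k)) / real k) + c))" .
  moreover have "prob (diagonal_event M X Y k m \<epsilon> p1 p2) = 1 - prob (\<Union>r\<in>?B. ?F r)"
    unfolding diagonal_event_eq[OF \<open>k \<ge> 1\<close>]
    using finB F by (intro prob_compl sets.finite_UN) auto
  ultimately show ?thesis by linarith
qed

end

theorem theorem2p2: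
  fixes M :: "'b measure" and \<A> :: "'a set" and X Y :: "nat \<Rightarrow> 'b \<Rightarrow> 'a"
    and \<epsilon> \<delta> p1 p2 :: real
  assumes "two_iid_words M \<A> X Y"
    and "\<epsilon> > 0"
    and "0 < p1" and "p1 < 1" and "1 < p2"
    and "gamma_tilde M X Y p1 < gamma_star M X Y"
    and "gamma_tilde M X Y p2 < gamma_star M X Y"
    and "\<delta> \<in> {0<..<min (gamma_star M X Y - gamma_tilde M X Y p1)
                      (gamma_star M X Y - gamma_tilde M X Y p2)}"
  shows "\<exists>n0 :: nat. \<forall>k m n :: nat.
           k \<ge> 1 \<longrightarrow> (1 + ln (real k)) / real k \<le> \<delta>\<^sup>2 * \<epsilon>\<^sup>2 / 16 \<longrightarrow>
           m \<ge> 1 \<longrightarrow> n = k * m \<longrightarrow> n \<ge> n0 \<longrightarrow>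
           measure M (diagonal_event M X Y k m \<epsilon> p1 p2)
             \<ge> 1 - exp (- real n * (- ((1 + ln (real k)) / real k) + \<delta>\<^sup>2 * \<epsilon>\<^sup>2 / 16))"
proof -
  interpret two_iid_words M \<A> X Y by fact
  let ?g = "gamma_star M X Y"
  define d where "d = min (?g - gamma_tilde M X Y p1) (?g - gamma_tilde M X Y p2)"
  have d: "0 < \<delta>" "\<delta> < d" using assms(8) by (auto simp: d_def)
  \<comment> \<open>The slack \<open>d - \<delta>\<close> pays for the distance of
    \<open>mean_lcs n n / n\<close> from its limit; the resulting \<open>n0\<close> depends on
    neither \<open>k\<close> nor \<open>m\<close>.\<close>
  have "?g - (d - \<delta>) * \<epsilon> / 2 < ?g" using d assms(2) by simp
  from order_tendstoD(1)[OF gamma_star_limit this]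
  obtain n0 where n0: "?g - (d - \<delta>) * \<epsilon> / 2 < mean_lcs n n / real n" if "n \<ge> n0" for n
    unfolding eventually_sequentially by blast
  have "1 - exp (- real (k * m) * (- ((1 + ln (real k)) / real k) + \<delta>\<^sup>2 * \<epsilon>\<^sup>2 / 16))
      \<le> prob (diagonal_event M X Y k m \<epsilon> p1 p2)"
    if "k \<ge> 1" "m \<ge> 1" "k * m \<ge> n0" for k m
  proof (rule prob_diagonal_event_ge)
    fix r assume r: "r \<in> bad_cuts k m \<epsilon> p1 p2"
    let ?n = "k * m" and ?s = "\<lambda>i. k * i"
    \<comment> \<open>The mean deficit exceeds
      \<open>(d \<epsilon> / 2 - (d - \<delta>) \<epsilon> / 2) n\<close>, which is this
      number.\<close>
    let ?t = "\<delta> * \<epsilon> * real ?n / 2"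
    have n: "?n > 0" using that by simp
    have cut: "cut_vector ?n m r" using r by (simp add: bad_cuts_def cut_vectors_def)
    note s = cut_vector_equidistant[OF \<open>k \<ge> 1\<close>, of m]
    have "(?g - (d - \<delta>) * \<epsilon> / 2) * real ?n < mean_lcs ?n ?n"
      using n0[OF that(3)] n by (subst (asm) pos_less_divide_eq) (simp_all only: of_nat_0_less_iff)
    moreover have "(\<Sum>i = 1..m. mean_lcs k (r i - r (i - 1))) \<le> ?g * real ?n - d * \<epsilon> * real ?n / 2"
      using r assms d \<open>k \<ge> 1\<close> by (intro sum_mean_lcs_le[OF cut]) (auto simp: d_def bad_cuts_def)
    moreover have "(\<Sum>i = 1..m. mean_lcs (?s i - ?s (i - 1)) (r i - r (i - 1))) =
        (\<Sum>i = 1..m. mean_lcs k (r i - r (i - 1)))"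
      by (rule sum.cong) (auto simp: diff_mult_distrib2[symmetric])
    ultimately have "?t \<le> expectation (\<lambda>\<omega>. lcs_deficit m ?s r (factor X 0 ?n \<omega>) (factor Y 0 ?n \<omega>))"
      unfolding expectation_lcs_deficit[OF s cut] by (simp add: algebra_simps diff_divide_distrib)
    moreover have "?t > 0" using d assms(2) n by simp
    ultimately have "prob {\<omega> \<in> space M. lcs_deficit m ?s r (factor X 0 ?n \<omega>) (factor Y 0 ?n \<omega>) \<le> 0}
        \<le> exp (- ?t\<^sup>2 / (4 * real ?n))"
      using n by (intro prob_lcs_deficit_le[OF s cut]) auto
    also have "- ?t\<^sup>2 / (4 * real ?n) = - real ?n * (\<delta>\<^sup>2 * \<epsilon>\<^sup>2 / 16)"
      using n by (simp add: field_simps power2_eq_square)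
    finally show "prob {\<omega> \<in> space M. lcs_deficit m ?s r (factor X 0 ?n \<omega>) (factor Y 0 ?n \<omega>) \<le> 0}
        \<le> exp (- real ?n * (\<delta>\<^sup>2 * \<epsilon>\<^sup>2 / 16))" .
  qed (use that in auto)
  then show ?thesis by blast
qed

end
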